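(* Let $\boldsymbol{w}_1,\ldots,\boldsymbol{w}_n\in\mathbb{R}^d$ be pairwise distinct vectors of Euclidean norm $1$, let $\boldsymbol{W}\in\mathbb{R}^{d\times n}$ be the matrix with these columns, and for $\beta>0$ let $f_\beta(\boldsymbol{x})=\boldsymbol{W}\,\mathcal{S}_\beta(\boldsymbol{W}^T\boldsymbol{x})$ be the associated continuous Hopfield function. Let $J\subset[n]$ be nonempty, and put $P:=\mathrm{cv}\{\boldsymbol{w}_j: j\in J\}$. Assume that $\{\boldsymbol{w}_j:j\in J\}$ is CIPS and that for every facet $F\in\mathcal{F}^{\dim(P)-1}(P)$ the set $\{\boldsymbol{w}_j: j\in I(F)\}$ is CIPS. Then there exist $\eta\in(0,1)$, $\varepsilon_0>0$ and a function $\beta:(0,\varepsilon_0)\to(0,\infty)$ with $\beta(\varepsilon)\to\infty$ as $\varepsilon\to0$, such that for every $\varepsilon\in(0,\varepsilon_0)$ the function $f=f_{\beta(\varepsilon)}$ satisfies $$(P_\eta)^{\varepsilon}\cap \mathrm{Fix}(f)\neq\emptyset .$$ Further, if $|J|>1$, there exists $\beta_0>0$ such that whenever $\beta(\varepsilon)>\beta_0$, all fixed points of $f_{\beta(\varepsilon)}$ in $(P_\eta)^{\varepsilon}$ are unstable.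
   Context: Notation: $[n]=\{1,\ldots,n\}$; $\mathrm{cv}$ denotes convex hull; $\boldsymbol{x}^{(j)}$ is the $j$-th component of $\boldsymbol{x}$; $\max\emptyset:=-\infty$. The scaled softmax is $\mathcal{S}_\beta:\mathbb{R}^n\to\mathbb{R}^n$, $\mathcal{S}_\beta(\boldsymbol{x})^{(i)}=\exp(\beta\boldsymbol{x}^{(i)})/\sum_{j=1}^n\exp(\beta\boldsymbol{x}^{(j)})$. $\mathrm{Fix}(f)$ is the set of $\boldsymbol{x}$ with $f(\boldsymbol{x})=\boldsymbol{x}$. A fixed point $\boldsymbol{x}^*$ of a continuously differentiable map $f$ is called unstable if the spectral radius of the Jacobian of $f$ at $\boldsymbol{x}^*$ is greater than $1$. CIPS (convexly inner product separated): for $I\subset[n]$, the subset $\{\boldsymbol{w}_j:j\in I\}$ of $\{\boldsymbol{w}_1,\ldots,\boldsymbol{w}_n\}$ is CIPS if $$\max\{\boldsymbol{w}_j^T\boldsymbol{v}: j\in I\}>\max\{\boldsymbol{w}_j^T\boldsymbol{v}: j\in[n]\setminus I\}\quad\text{for all }\boldsymbol{v}\in\mathrm{cv}\{\boldsymbol{w}_j:j\in I\}.$$ Polytopes: $\dim(P)$ is the dimension of the affine hull of $P$. For $0\le k\le\dim(P)$, $\mathcal{F}^k(P)$ is the set of $k$-dimensional faces of $P$; the elements of $\mathcal{F}^{\dim(P)-1}(P)$ are the facets (there are none, so the facet hypothesis is vacuous, if $\dim(P)=0$). Since the $\boldsymbol{w}_j$ are distinct unit vectors, each $\boldsymbol{w}_j$,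 $j\in J$, is a vertex of $P$; for a face $F$ of $P$, $I(F)\subset J$ is the set of indices with $F=\mathrm{cv}\{\boldsymbol{w}_j:j\in I(F)\}$, i.e. the indices of the vertices of $F$. Scaled and thickened polytopes: let $\boldsymbol{b}_P$ be the arithmetic mean of the vertices of $P$. For $\eta\in(0,1)$, $P_\eta:=\eta(P-\boldsymbol{b}_P)+\boldsymbol{b}_P$. Let $m:=d-\dim(P)$ and let $\boldsymbol{v}_1,\ldots,\boldsymbol{v}_m$ be a (fixed, arbitrary) orthonormal basis of the linear subspace orthogonal to the affine hull of $P$. Define $$C(P^\perp):=\Big\{\sum_{j=1}^m\alpha_j\tilde{\boldsymbol{v}}_j:\ \sum_{j=1}^m\alpha_j\le1,\ \alpha_j\ge0,\ \tilde{\boldsymbol{v}}_j\in\{\boldsymbol{v}_j,-\boldsymbol{v}_j\}\text{ for }j=1,\ldots,m\Big\}$$ (equal to $\{0\}$ if $m=0$). For $\varepsilon>0$, $(P_\eta)^\varepsilon:=P_\eta+\varepsilon\,C(P^\perp)$ (Minkowski sum). *)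

theory Defs
  imports "HOL-Analysis.Analysis"
begin

definition softmax :: "real \<Rightarrow> real ^ 'n \<Rightarrow> real ^ 'n" where
  "softmax \<beta> x = (\<chi> i. exp (\<beta> * x $ i) / (\<Sum>j\<in>UNIV. exp (\<beta> * x $ j)))"

definition pattern_matrix :: "('n \<Rightarrow> real ^ 'd) \<Rightarrow> real ^ 'n ^ 'd" where
  "pattern_matrix w = (\<chi> i j. w j $ i)"

definition hopfield :: "real ^ 'n ^ 'd \<Rightarrow> real \<Rightarrow> real ^ 'd \<Rightarrow> real ^ 'd" where
  "hopfield W \<beta> x = W *v softmax \<beta> (transpose W *v x)"

definition Fix :: "('a \<Rightarrow> 'a) \<Rightarrow> 'a set" where
  "Fix f = {x. f x = x}"

definition complex_spectrum :: "real ^ 'd ^ 'd \<Rightarrow> complex set" where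
  "complex_spectrum A =
     {l. \<exists>v :: complex ^ 'd. v \<noteq> 0 \<and> map_matrix complex_of_real A *v v = l *s v}"

definition spectral_radius :: "real ^ 'd ^ 'd \<Rightarrow> real" where
  "spectral_radius A = (SUP l\<in>complex_spectrum A. cmod l)"

definition jacobian :: "(real ^ 'd \<Rightarrow> real ^ 'd) \<Rightarrow> real ^ 'd \<Rightarrow> real ^ 'd ^ 'd" where
  "jacobian f x = matrix (frechet_derivative f (at x))"

(* Meant for continuously differentiable f; otherwise the Jacobian is unspecified. *)
definition unstable_fixed_point :: "(real ^ 'd \<Rightarrow> real ^ 'd) \<Rightarrow> real ^ 'd \<Rightarrow> bool" where
  "unstable_fixed_point f x \<longleftrightarrow> x \<in> Fix f \<and> spectral_radius (jacobian f x) > 1"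

(* The suprema are over finite sets, hence maxima; in ereal the supremum of the
   empty set is -\<infinity>. *)
definition CIPS :: "('n::finite \<Rightarrow> real ^ 'd) \<Rightarrow> 'n set \<Rightarrow> bool" where
  "CIPS w I \<longleftrightarrow>
     (\<forall>v \<in> convex hull (w ` I).
        (SUP j\<in>I. ereal (w j \<bullet> v)) > (SUP j\<in>UNIV - I. ereal (w j \<bullet> v)))"

definition vertex_indices :: "('n \<Rightarrow> real ^ 'd) \<Rightarrow> 'n set \<Rightarrow> (real ^ 'd) set \<Rightarrow> 'n set" where
  "vertex_indices w J F = {j \<in> J. w j extreme_point_of F}"

definition vertex_mean :: "(real ^ 'd) set \<Rightarrow> real ^ 'd" where
  "vertex_mean P = (\<Sum>x | x extreme_point_of P. x) /\<^sub>R real (card {x. x extreme_point_of P})"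

definition scaled_polytope :: "(real ^ 'd) set \<Rightarrow> real \<Rightarrow> (real ^ 'd) set" where
  "scaled_polytope P \<eta> = (\<lambda>x. \<eta> *\<^sub>R (x - vertex_mean P) + vertex_mean P) ` P"

(* Orthogonality to an affine subspace means orthogonality to its direction space,
   so a basis has d - dim P elements. *)
definition affine_orthogonal :: "(real ^ 'd) set \<Rightarrow> (real ^ 'd) set" where
  "affine_orthogonal P =
     {v. \<forall>x \<in> affine hull P. \<forall>y \<in> affine hull P. orthogonal v (x - y)}"

definition orthonormal_basis_of :: "(real ^ 'd) set \<Rightarrow> (real ^ 'd) set \<Rightarrow> bool" where
  "orthonormal_basis_of B S \<longleftrightarrow>
     pairwise orthogonal B \<and> (\<forall>v\<in>B. norm v = 1) \<and> span B = S"

definition cross_polytope :: "(real ^ 'd) set \<Rightarrow> (real ^ 'd) set" where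
  "cross_polytope B =
     {(\<Sum>v\<in>B. \<alpha> v *\<^sub>R s v) | \<alpha> s.
        (\<Sum>v\<in>B. \<alpha> v) \<le> 1 \<and> (\<forall>v\<in>B. \<alpha> v \<ge> 0) \<and> (\<forall>v\<in>B. s v \<in> {v, - v})}"

definition thickened_polytope ::
    "(real ^ 'd) set \<Rightarrow> (real ^ 'd) set \<Rightarrow> real \<Rightarrow> real \<Rightarrow> (real ^ 'd) set" where
  "thickened_polytope P B \<eta> \<epsilon> =
     {p + \<epsilon> *\<^sub>R c | p c. p \<in> scaled_polytope P \<eta> \<and> c \<in> cross_polytope B}"

lemma hopfield_differentiable: "hopfield W \<beta> differentiable (at x)"
proof -
  have nz: "(\<Sum>j\<in>UNIV. exp (\<beta> * (transpose W *v y) $ j)) \<noteq> 0" for y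
    by (metis exp_gt_zero finite_UNIV_card_ge_0 finite less_irrefl sum_pos UNIV_not_empty)
  have lin: "(\<lambda>y. (transpose W *v y) $ j) differentiable (at x)" for j
    by (intro bounded_linear_imp_differentiable
          bounded_linear_compose[OF bounded_linear_vec_nth matrix_vector_mul_bounded_linear])
  have ex: "(\<lambda>y. exp (\<beta> * (transpose W *v y) $ j)) differentiable (at x)" for j
  proof -
    have "(\<lambda>y. \<beta> * (transpose W *v y) $ j) differentiable (at x)"
      by (intro differentiable_mult lin) simp
    then obtain D where "((\<lambda>y. \<beta> * (transpose W *v y) $ j) has_derivative D) (at x)"
      by (auto simp: differentiable_def)
    from has_derivative_exp[OF this] show ?thesis
      by (auto simp: differentiable_def)
  qed
  have sm: "(\<lambda>y. softmax \<beta> (transpose W *v y) $ i) differentiable (at x)" for i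
    unfolding softmax_def vec_lambda_beta
    by (intro differentiable_divide differentiable_sum ballI ex nz finite)
  have "(\<lambda>y. hopfield W \<beta> y \<bullet> axis k 1) differentiable (at x)" for k
    unfolding hopfield_def inner_axis matrix_vector_mult_def[of W] vec_lambda_beta inner_real_def mult_1_right
    by (intro differentiable_sum differentiable_mult ballI sm finite differentiable_const)
  then show ?thesis
    by (subst differentiable_componentwise_within) (auto simp: Basis_vec_def)
qed

end

theory Submission
  imports Defs
begin

text \<open>
  CIPS of the index set of a face makes the softmax weights outside that face exponentially small
  in \<open>\<beta>\<close>, uniformly near the face. Hence, on the thickened polytope, the displacement
  \<open>f x - x\<close> points inwards in the directions normal to \<open>P\<close> (CIPS of \<open>J\<close>) and outwards across
  every facet of \<open>P\<^sub>\<eta>\<close> (CIPS of the facets). Reversing a small multiple of its tangential part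
  gives a self-map with the same fixed points, to which Brouwer's theorem applies.

  The Jacobian of \<open>f\<close> is \<open>\<beta>\<close> times the covariance matrix of the patterns under the softmax
  weights. At a fixed point \<open>x\<close> its trace is \<open>\<beta> (1 - \<bar>x\<bar>\<^sup>2)\<close>, since the patterns are unit vectors
  with mean \<open>x\<close>; when \<open>P\<close> has at least two vertices, \<open>\<bar>x\<bar>\<close> stays away from \<open>1\<close>, so the largest
  eigenvalue grows linearly in \<open>\<beta>\<close>.
\<close>

section \<open>Softmax weights, and the Hopfield map as a weighted mean of the patterns\<close>

definition hopfield_weight :: "('n::finite \<Rightarrow> real ^ 'd) \<Rightarrow> real \<Rightarrow> real ^ 'd \<Rightarrow> 'n \<Rightarrow> real" where
  "hopfield_weight w \<beta> x i = exp (\<beta> * (w i \<bullet> x)) / (\<Sum>j\<in>UNIV. exp (\<beta> * (w j \<bullet> x)))"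

lemma transpose_pattern_matrix_mult:
  fixes w :: "'n::finite \<Rightarrow> real ^ 'd"
  shows "(transpose (pattern_matrix w) *v x) $ j = w j \<bullet> x"
  by (simp add: transpose_def pattern_matrix_def matrix_vector_mult_def inner_vec_def)

lemma hopfield_eq_sum:
  fixes w :: "'n::finite \<Rightarrow> real ^ 'd"
  shows "hopfield (pattern_matrix w) \<beta> x = (\<Sum>j\<in>UNIV. hopfield_weight w \<beta> x j *\<^sub>R w j)"
proof -
  have "softmax \<beta> (transpose (pattern_matrix w) *v x) = (\<chi> j. hopfield_weight w \<beta> x j)"
    unfolding softmax_def transpose_pattern_matrix_mult hopfield_weight_def ..
  then show ?thesis
    by (simp add: hopfield_def vec_eq_iff matrix_vector_mult_def pattern_matrix_def mult.commute)
qed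

lemma sum_exp_pos: "(\<Sum>j\<in>(UNIV::'n::finite set). exp (g j :: real)) > 0"
  by (simp add: sum_pos)

lemma hopfield_weight_nonneg: "hopfield_weight w \<beta> x i \<ge> 0"
  unfolding hopfield_weight_def by (simp add: sum_nonneg)

lemma sum_hopfield_weight: "(\<Sum>j\<in>UNIV. hopfield_weight w \<beta> x j) = 1"
  unfolding hopfield_weight_def
  using sum_exp_pos[of "\<lambda>j. \<beta> * (w j \<bullet> x)"] by (simp flip: sum_divide_distrib)

text \<open>Keeping only the term of \<open>j\<close> in the denominator leaves the exponential of
  \<beta> times the score difference of \<open>i\<close> and \<open>j\<close>.\<close>

lemma hopfield_weight_le_exp:
  fixes w :: "'n::finite \<Rightarrow> real ^ 'd"
  assumes "\<beta> \<ge> 0" "w i \<bullet> x + g \<le> w j \<bullet> x"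
  shows "hopfield_weight w \<beta> x i \<le> exp (- \<beta> * g)"
proof -
  have "hopfield_weight w \<beta> x i \<le> exp (\<beta> * (w i \<bullet> x)) / exp (\<beta> * (w j \<bullet> x))"
    unfolding hopfield_weight_def
    by (intro divide_left_mono mult_pos_pos sum_exp_pos member_le_sum) auto
  also have "\<dots> = exp (\<beta> * (w i \<bullet> x - w j \<bullet> x))"
    by (simp add: exp_diff algebra_simps)
  also have "\<dots> \<le> exp (- \<beta> * g)"
    using mult_left_mono[of "w i \<bullet> x - w j \<bullet> x" "- g" \<beta>] assms by simp
  finally show ?thesis .
qed

text \<open>The weights sum to 1, so a constant can be moved into the mean. After this centring,
  every pattern on the hyperplane \<open>a \<bullet> y = c\<close> contributes nothing.\<close>

lemma inner_hopfield_minus: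
  fixes w :: "'n::finite \<Rightarrow> real ^ 'd"
  shows "a \<bullet> hopfield (pattern_matrix w) \<beta> x - c
           = (\<Sum>j\<in>UNIV. hopfield_weight w \<beta> x j * (a \<bullet> w j - c))"
proof -
  have "(\<Sum>j\<in>UNIV. hopfield_weight w \<beta> x j * c) = c"
    by (simp flip: sum_distrib_right add: sum_hopfield_weight)
  then show ?thesis
    by (simp add: hopfield_eq_sum inner_sum_right right_diff_distrib sum_subtractf)
qed

text \<open>Only indices outside \<open>I\<close> survive the centring, and each of them has weight
  at most \<open>exp (- \<beta> * g)\<close>. The estimate is used twice: for directions normal to
  the polytope with \<open>I = J\<close>, and for a facet normal with \<open>I\<close> the set of
  patterns on the facet hyperplane.\<close>

lemma inner_hopfield_close:
  fixes w :: "'n::finite \<Rightarrow> real ^ 'd"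
  assumes "\<beta> \<ge> 0" and "j \<in> I" and "\<And>i. i \<notin> I \<Longrightarrow> w i \<bullet> x + g \<le> w j \<bullet> x"
    and I: "\<And>i. i \<in> I \<Longrightarrow> a \<bullet> w i = c" and M: "\<And>i. \<bar>a \<bullet> w i - c\<bar> \<le> M"
  shows "\<bar>a \<bullet> hopfield (pattern_matrix w) \<beta> x - c\<bar> \<le> real CARD('n) * M * exp (- \<beta> * g)"
proof -
  have "\<bar>a \<bullet> hopfield (pattern_matrix w) \<beta> x - c\<bar>
      \<le> (\<Sum>j\<in>UNIV. \<bar>hopfield_weight w \<beta> x j * (a \<bullet> w j - c)\<bar>)"
    unfolding inner_hopfield_minus by (rule sum_abs)
  also have "\<dots> \<le> (\<Sum>j\<in>(UNIV::'n set). exp (- \<beta> * g) * M)"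
  proof (rule sum_mono)
    fix i :: 'n
    have "M \<ge> 0" using M[of i] by linarith
    show "\<bar>hopfield_weight w \<beta> x i * (a \<bullet> w i - c)\<bar> \<le> exp (- \<beta> * g) * M"
    proof (cases "i \<in> I")
      case True
      then show ?thesis using I \<open>M \<ge> 0\<close> by simp
    next
      case False
      then show ?thesis
        using hopfield_weight_le_exp[of \<beta> w i x g j] assms(1,3) M[of i]
        by (auto simp: abs_mult hopfield_weight_nonneg intro!: mult_mono)
    qed
  qed
  finally show ?thesis by (simp add: mult_ac)
qed

lemma norm_hopfield_le:
  fixes w :: "'n::finite \<Rightarrow> real ^ 'd"
  assumes "\<And>j. norm (w j) \<le> r"
  shows "norm (hopfield (pattern_matrix w) \<beta> x) \<le> r"
proof -
  have "norm (hopfield (pattern_matrix w) \<beta> x) \<le> (\<Sum>j\<in>UNIV. hopfield_weight w \<beta> x j * r)"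
    unfolding hopfield_eq_sum
    by (rule order_trans[OF norm_sum sum_mono]) (simp add: hopfield_weight_nonneg assms mult_left_mono)
  then show ?thesis
    by (simp flip: sum_distrib_right add: sum_hopfield_weight)
qed

lemma continuous_on_hopfield: "continuous_on S (hopfield W \<beta>)"
  by (meson continuous_at_imp_continuous_on differentiable_imp_continuous_within hopfield_differentiable)

section \<open>Derivative and Jacobian of the Hopfield map\<close>

text \<open>The logarithmic derivative of a softmax weight is \<beta> times the score minus the mean
  score, which is where the factor \<open>w j - hopfield (pattern_matrix w) \<beta> x\<close> comes
  from.\<close>

lemma hopfield_has_derivative:
  fixes w :: "'n::finite \<Rightarrow> real ^ 'd"
  shows "(hopfield (pattern_matrix w) \<beta> has_derivative
     (\<lambda>u. \<Sum>j\<in>UNIV. (\<beta> * hopfield_weight w \<beta> x j *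
        ((w j - hopfield (pattern_matrix w) \<beta> x) \<bullet> u)) *\<^sub>R w j)) (at x)"
proof -
  let ?S = "\<lambda>y. \<Sum>j\<in>UNIV. exp (\<beta> * (w j \<bullet> y))"
  have nz: "?S y \<noteq> 0" for y
    using sum_exp_pos[of "\<lambda>j. \<beta> * (w j \<bullet> y)"] by linarith
  have *: "((\<lambda>y. hopfield_weight w \<beta> y j) has_derivative
      (\<lambda>u. \<beta> * hopfield_weight w \<beta> x j * ((w j - hopfield (pattern_matrix w) \<beta> x) \<bullet> u))) (at x)" for j
  proof -
    have d: "((\<lambda>y. exp (\<beta> * (w j \<bullet> y))) has_derivative
        (\<lambda>u. exp (\<beta> * (w j \<bullet> x)) * (\<beta> * (w j \<bullet> u)))) (at x)" for j
      by (auto intro!: derivative_eq_intros)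
    have s: "(?S has_derivative (\<lambda>u. \<Sum>j\<in>UNIV. exp (\<beta> * (w j \<bullet> x)) * (\<beta> * (w j \<bullet> u)))) (at x)"
      by (intro has_derivative_sum d)
    have eq: "(\<Sum>j\<in>UNIV. exp (\<beta> * (w j \<bullet> x)) * (\<beta> * (w j \<bullet> u)))
       = \<beta> * ?S x * (hopfield (pattern_matrix w) \<beta> x \<bullet> u)" for u
    proof -
      have "?S x * hopfield_weight w \<beta> x j = exp (\<beta> * (w j \<bullet> x))" for j
        using nz[of x] by (simp add: hopfield_weight_def)
      then have "?S x * (hopfield (pattern_matrix w) \<beta> x \<bullet> u)
          = (\<Sum>j\<in>UNIV. exp (\<beta> * (w j \<bullet> x)) * (w j \<bullet> u))"
        unfolding hopfield_eq_sum inner_sum_left inner_scaleR_left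
        by (subst sum_distrib_left) (simp flip: mult.assoc)
      then show ?thesis
        unfolding mult.assoc[of \<beta>] by (simp add: sum_distrib_left[of \<beta>] mult_ac)
    qed
    show ?thesis
      unfolding hopfield_weight_def[of w \<beta> _ j]
      by (rule has_derivative_eq_rhs[OF has_derivative_divide'[OF d s nz]], unfold eq, rule ext)
         (use nz[of x] in \<open>simp add: divide_simps inner_diff_left, simp add: algebra_simps\<close>)
  qed
  show ?thesis
    unfolding hopfield_eq_sum[abs_def]
    by (intro has_derivative_sum has_derivative_scaleR_left *[unfolded hopfield_eq_sum])
qed

text \<open>The bracket is the covariance of the scores of \<open>u\<close> and \<open>v\<close>
  under the softmax weights. Its symmetry in \<open>u\<close> and \<open>v\<close> is what gives
  access to Rayleigh quotients.\<close>

lemma inner_jacobian_hopfield: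
  fixes w :: "'n::finite \<Rightarrow> real ^ 'd"
  shows "v \<bullet> (jacobian (hopfield (pattern_matrix w) \<beta>) x *v u) =
     \<beta> * ((\<Sum>j\<in>UNIV. hopfield_weight w \<beta> x j * (w j \<bullet> u) * (w j \<bullet> v))
        - (hopfield (pattern_matrix w) \<beta> x \<bullet> u) * (hopfield (pattern_matrix w) \<beta> x \<bullet> v))"
proof -
  let ?f = "hopfield (pattern_matrix w) \<beta>"
  have lin: "linear (frechet_derivative ?f (at x))"
    by (rule linear_frechet_derivative[OF hopfield_differentiable])
  have "jacobian ?f x *v u = frechet_derivative ?f (at x) u"
    unfolding jacobian_def by (rule matrix_works) (use lin in \<open>simp add: linear_def scalar_mult_eq_scaleR[abs_def]\<close>)
  also have "\<dots> = (\<Sum>j\<in>UNIV. (\<beta> * hopfield_weight w \<beta> x j * ((w j - ?f x) \<bullet> u)) *\<^sub>R w j)"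
    by (simp flip: frechet_derivative_at[OF hopfield_has_derivative])
  finally have "v \<bullet> (jacobian ?f x *v u) =
      (\<Sum>j\<in>UNIV. \<beta> * hopfield_weight w \<beta> x j * (w j \<bullet> u - ?f x \<bullet> u) * (w j \<bullet> v))"
    by (simp add: inner_sum_right inner_diff_left inner_commute[of v])
  also have "\<dots> = \<beta> * ((\<Sum>j\<in>UNIV. hopfield_weight w \<beta> x j * (w j \<bullet> u) * (w j \<bullet> v))
         - (?f x \<bullet> u) * (\<Sum>j\<in>UNIV. hopfield_weight w \<beta> x j * (w j \<bullet> v)))"
    by (simp add: sum_distrib_left sum_subtractf algebra_simps)
  also have "(\<Sum>j\<in>UNIV. hopfield_weight w \<beta> x j * (w j \<bullet> v)) = ?f x \<bullet> v"
    by (simp add: hopfield_eq_sum inner_sum_left)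
  finally show ?thesis .
qed

text \<open>By Parseval, the second moments along the basis add up to the mean squared norm of the
  patterns, which is 1 for unit vectors.\<close>

lemma trace_jacobian_hopfield:
  fixes w :: "'n::finite \<Rightarrow> real ^ 'd"
  assumes "\<And>j. norm (w j) = 1"
  shows "(\<Sum>e\<in>Basis. e \<bullet> (jacobian (hopfield (pattern_matrix w) \<beta>) x *v e))
     = \<beta> * (1 - (norm (hopfield (pattern_matrix w) \<beta> x))\<^sup>2)"
proof -
  let ?f = "hopfield (pattern_matrix w) \<beta> x"
  have parseval: "(\<Sum>e\<in>Basis. (y \<bullet> e) * (y \<bullet> e)) = (norm y)\<^sup>2" for y :: "real ^ 'd"
    by (simp add: power2_norm_eq_inner euclidean_inner[of y y])
  have "(\<Sum>e\<in>Basis. \<Sum>j\<in>UNIV. hopfield_weight w \<beta> x j * (w j \<bullet> e) * (w j \<bullet> e))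
      = (\<Sum>j\<in>UNIV. hopfield_weight w \<beta> x j * (\<Sum>e\<in>Basis. (w j \<bullet> e) * (w j \<bullet> e)))"
    by (subst sum.swap) (simp add: sum_distrib_left mult.assoc)
  also have "\<dots> = 1"
    by (simp add: parseval assms sum_hopfield_weight)
  finally show ?thesis
    by (simp add: inner_jacobian_hopfield sum_subtractf parseval flip: sum_distrib_left)
qed

section \<open>Spectral radius, Rayleigh quotients and instability\<close>

text \<open>The spectral radius is a supremum of reals, so an eigenvalue bounds it from below only
  once the spectrum is known to be bounded. The bound comes from summing the eigenvector equation in
  the l1 norm.\<close>

lemma bdd_above_complex_spectrum: "bdd_above (cmod ` complex_spectrum (A :: real ^ 'd ^ 'd))"
proof -
  let ?M = "\<Sum>i\<in>UNIV. \<Sum>j\<in>UNIV. \<bar>A $ i $ j\<bar>"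
  have "cmod l \<le> ?M" if "l \<in> complex_spectrum A" for l
  proof -
    obtain v :: "complex ^ 'd" where v: "v \<noteq> 0" "map_matrix complex_of_real A *v v = l *s v"
      using \<open>l \<in> complex_spectrum A\<close> by (auto simp: complex_spectrum_def)
    let ?s = "\<Sum>j\<in>UNIV. cmod (v $ j)"
    have "?s > 0"
    proof -
      obtain k where "v $ k \<noteq> 0" using v(1) by (auto simp: vec_eq_iff)
      then show ?thesis by (intro sum_pos2[of _ k]) auto
    qed
    have "cmod l * cmod (v $ i) \<le> (\<Sum>j\<in>UNIV. \<bar>A $ i $ j\<bar>) * ?s" for i
    proof -
      have "l * v $ i = (\<Sum>j\<in>UNIV. complex_of_real (A $ i $ j) * v $ j)"
        using arg_cong[OF v(2), of "\<lambda>y. y $ i"]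
        by (simp add: matrix_vector_mult_def map_matrix_def)
      then have "cmod l * cmod (v $ i) \<le> (\<Sum>j\<in>UNIV. \<bar>A $ i $ j\<bar> * cmod (v $ j))"
        by (metis (no_types, lifting) norm_mult norm_of_real norm_sum sum.cong)
      also have "\<dots> \<le> (\<Sum>j\<in>UNIV. \<bar>A $ i $ j\<bar> * ?s)"
        by (intro sum_mono mult_left_mono member_le_sum) auto
      finally show ?thesis by (simp add: sum_distrib_right)
    qed
    then have "(\<Sum>i\<in>UNIV. cmod l * cmod (v $ i)) \<le> (\<Sum>i\<in>UNIV. (\<Sum>j\<in>UNIV. \<bar>A $ i $ j\<bar>) * ?s)"
      by (intro sum_mono)
    then have "cmod l * ?s \<le> ?M * ?s"
      by (simp only: flip: sum_distrib_left sum_distrib_right)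
    then show ?thesis using \<open>?s > 0\<close> by simp
  qed
  then show ?thesis by (auto simp: bdd_above_def)
qed

text \<open>The maximum of the Rayleigh quotient of a symmetric matrix is an eigenvalue.\<close>

lemma rayleigh_le_spectral_radius:
  fixes A :: "real ^ 'd ^ 'd"
  assumes sym: "\<And>u v. u \<bullet> (A *v v) = v \<bullet> (A *v u)" and "norm e = 1"
  shows "e \<bullet> (A *v e) \<le> spectral_radius A"
proof -
  have "continuous_on (sphere 0 1) (\<lambda>v. v \<bullet> (A *v v))"
    by (intro continuous_intros matrix_vector_mult_linear_continuous_on)
  moreover have "e \<in> sphere 0 1" using \<open>norm e = 1\<close> by simp
  ultimately obtain v where v: "v \<in> sphere 0 1"
      and max: "\<And>u. u \<in> sphere 0 1 \<Longrightarrow> u \<bullet> (A *v u) \<le> v \<bullet> (A *v v)"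
    using continuous_attains_sup[of "sphere 0 1" "\<lambda>v. v \<bullet> (A *v v)"] by auto
  define l where "l = v \<bullet> (A *v v)"
  \<comment> \<open>\<open>q\<close> is the quadratic form of \<open>l\<close> times the identity
    minus \<open>A\<close>. It is nonnegative and vanishes at the maximiser \<open>v\<close>, so its
    first variation at \<open>v\<close>, twice the residual \<open>r\<close> below, must be
    zero.\<close>
  define q where "q u = l * (u \<bullet> u) - u \<bullet> (A *v u)" for u
  have q_nonneg: "q u \<ge> 0" for u
  proof (cases "u = 0")
    case False
    have "(u /\<^sub>R norm u) \<bullet> (A *v (u /\<^sub>R norm u)) \<le> l"
      unfolding l_def by (rule max) (use False in simp)
    then show ?thesis
      using False
      by (simp add: q_def matrix_vector_mult_scaleR divide_simps power2_eq_square flip: power2_norm_eq_inner)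
  qed (simp add: q_def)
  have "A *v v = l *\<^sub>R v"
  proof -
    define r where "r = l *\<^sub>R v - A *v v"
    have exp: "q (v + t *\<^sub>R r) = 2 * t * (r \<bullet> r) + t\<^sup>2 * q r" for t
    proof -
      have "q (v + t *\<^sub>R r) = q v + 2 * t * (l * (r \<bullet> v) - r \<bullet> (A *v v)) + t\<^sup>2 * q r"
        using sym[of v r]
        by (simp add: q_def matrix_vector_right_distrib matrix_vector_mult_scaleR inner_add_left
            inner_add_right inner_commute power2_eq_square algebra_simps)
      moreover have "q v = 0"
        using v by (simp add: q_def l_def flip: power2_norm_eq_inner)
      moreover have "l * (r \<bullet> v) - r \<bullet> (A *v v) = r \<bullet> r"
        by (simp add: r_def inner_diff_right)
      ultimately show ?thesis by simp
    qed
    have "r \<bullet> r = 0"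
    proof (rule ccontr)
      assume "r \<bullet> r \<noteq> 0"
      then have rr: "r \<bullet> r > 0" by (simp add: less_le)
      \<comment> \<open>A negative step short enough for the linear term to dominate the quadratic
        one, which would make \<open>q\<close> negative. The summand 1 keeps the denominator
        positive when \<open>q r = 0\<close>.\<close>
      define t where "t = - (r \<bullet> r) / (q r + 1)"
      have "t < 0" using rr q_nonneg[of r] by (simp add: t_def divide_neg_pos)
      have "t * (q r + 1) = - (r \<bullet> r)" using q_nonneg[of r] by (simp add: t_def)
      then have "t * q r = - (r \<bullet> r) - t" by (simp add: algebra_simps)
      then have "2 * (r \<bullet> r) + t * q r > 0" using rr \<open>t < 0\<close> by linarith
      then have "t * (2 * (r \<bullet> r) + t * q r) < 0"
        using \<open>t < 0\<close> by (simp add: mult_neg_pos)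
      then show False
        using exp[of t] q_nonneg[of "v + t *\<^sub>R r"] by (simp add: power2_eq_square algebra_simps)
    qed
    then show ?thesis by (simp add: r_def)
  qed
  then have "map_matrix complex_of_real A *v (\<chi> i. complex_of_real (v $ i))
      = complex_of_real l *s (\<chi> i. complex_of_real (v $ i))"
    by (simp add: vec_eq_iff matrix_vector_mult_def map_matrix_def flip: of_real_mult of_real_sum)
  moreover have "(\<chi> i. complex_of_real (v $ i)) \<noteq> 0"
  proof
    assume "(\<chi> i. complex_of_real (v $ i)) = 0"
    then have "v = 0" by (simp add: vec_eq_iff)
    then show False using v by simp
  qed
  ultimately have "complex_of_real l \<in> complex_spectrum A"
    by (auto simp: complex_spectrum_def)
  then have "cmod (complex_of_real l) \<le> spectral_radius A"
    unfolding spectral_radius_def by (rule cSUP_upper[OF _ bdd_above_complex_spectrum])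
  then show ?thesis
    using max[of e] \<open>norm e = 1\<close> by (simp add: l_def)
qed

lemma trace_le_spectral_radius:
  fixes A :: "real ^ 'd ^ 'd"
  assumes sym: "\<And>u v. u \<bullet> (A *v v) = v \<bullet> (A *v u)"
  shows "(\<Sum>e\<in>Basis. e \<bullet> (A *v e)) \<le> real CARD('d) * spectral_radius A"
proof -
  have "(\<Sum>e\<in>Basis. e \<bullet> (A *v e)) \<le> (\<Sum>e\<in>(Basis::(real^'d) set). spectral_radius A)"
    by (intro sum_mono rayleigh_le_spectral_radius[OF sym]) simp
  then show ?thesis by simp
qed

text \<open>At a fixed point the mean of the patterns is \<open>x\<close> itself, so the left side
  of the last hypothesis is the trace of the Jacobian. A trace above the dimension forces some
  Rayleigh quotient above 1.\<close>

lemma unstable_fixed_point_hopfield: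
  fixes w :: "'n::finite \<Rightarrow> real ^ 'd"
  assumes unit: "\<And>j. norm (w j) = 1"
    and x: "x \<in> Fix (hopfield (pattern_matrix w) \<beta>)"
    and \<beta>: "\<beta> * (1 - (norm x)\<^sup>2) > real CARD('d)"
  shows "unstable_fixed_point (hopfield (pattern_matrix w) \<beta>) x"
proof -
  let ?A = "jacobian (hopfield (pattern_matrix w) \<beta>) x"
  have "\<beta> * (1 - (norm x)\<^sup>2) \<le> real CARD('d) * spectral_radius ?A"
    using trace_le_spectral_radius[of ?A] trace_jacobian_hopfield[of w \<beta> x, OF unit] x
    by (simp add: inner_jacobian_hopfield Fix_def mult_ac)
  then have "real CARD('d) * 1 < real CARD('d) * spectral_radius ?A"
    using \<beta> by linarith
  then show ?thesis
    using x by (simp add: unstable_fixed_point_def)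
qed

section \<open>Uniform gaps by compactness\<close>

text \<open>A strict inequality on a compact hull persists with a uniform margin in a neighbourhood.
  One number \<open>g\<close> serves as both radius and margin; the winning index \<open>j\<close>
  may vary with \<open>u\<close>.\<close>

lemma CIPS_uniform_gap:
  fixes w :: "'n::finite \<Rightarrow> real ^ 'd"
  assumes "CIPS w I"
  obtains g where "g > 0"
    and "\<And>u v. v \<in> convex hull (w ` I) \<Longrightarrow> dist u v \<le> g
           \<Longrightarrow> \<exists>j\<in>I. \<forall>i. i \<notin> I \<longrightarrow> w i \<bullet> u + g \<le> w j \<bullet> u"
proof -
  let ?C = "convex hull (w ` I)"
  \<comment> \<open>The gap is an extra coordinate, so that one separation argument bounds it together with the distance.\<close>
  define Z where "Z = (\<Inter>j\<in>I. \<Union>i\<in>-I. {z. w j \<bullet> fst z \<le> w i \<bullet> fst z + (snd z :: real)})"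
  have "closed Z"
    unfolding Z_def
    by (intro closed_INT closed_UN ballI finite closed_Collect_le continuous_intros)
  moreover have "compact (?C \<times> {0::real})"
    by (intro compact_Times compact_convex_hull finite_imp_compact) auto
  moreover have "(?C \<times> {0}) \<inter> Z = {}"
  proof -
    have "(v, 0) \<notin> Z" if "v \<in> ?C" for v
    proof -
      have "(SUP j\<in>UNIV - I. ereal (w j \<bullet> v)) < (SUP j\<in>I. ereal (w j \<bullet> v))"
        using assms that by (auto simp: CIPS_def)
      \<comment> \<open>In \<open>ereal\<close> the case \<open>I = UNIV\<close> needs no separate
        treatment: the supremum over the empty complement is the bottom element.\<close>
      then obtain j where j: "j \<in> I" "(SUP j\<in>UNIV - I. ereal (w j \<bullet> v)) < ereal (w j \<bullet> v)"
        by (auto simp: less_SUP_iff)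
      have "w i \<bullet> v < w j \<bullet> v" if "i \<notin> I" for i
      proof -
        have "ereal (w i \<bullet> v) \<le> (SUP j\<in>UNIV - I. ereal (w j \<bullet> v))"
          by (rule SUP_upper) (use that in simp)
        then have "ereal (w i \<bullet> v) < ereal (w j \<bullet> v)" using j(2) by (rule le_less_trans)
        then show ?thesis by simp
      qed
      then show ?thesis using j(1) by (force simp: Z_def not_le)
    qed
    then show ?thesis by auto
  qed
  ultimately obtain d where d: "d > 0" "\<And>x z. x \<in> ?C \<times> {0} \<Longrightarrow> z \<in> Z \<Longrightarrow> d \<le> dist x z"
    using separate_compact_closed[of "?C \<times> {0}" Z] by blast
  show thesis
  proof (rule that[of "d / 3"])
    fix u v assume v: "v \<in> ?C" "dist u v \<le> d / 3"
    \<comment> \<open>Distance and gap each use up a third of \<open>d\<close>, so the total stays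
      strictly below \<open>d\<close>.\<close>
    have "dist (v, 0) (u, d / 3) \<le> dist v u + dist 0 (d / 3)"
      using norm_Pair_le[of "v - u" "0 - d / 3"] by (simp add: dist_norm)
    also have "\<dots> < d" using v(2) \<open>d > 0\<close> by (simp add: dist_commute)
    finally have "(u, d / 3) \<notin> Z" using d(2)[of "(v, 0)" "(u, d / 3)"] v(1) by auto
    then show "\<exists>j\<in>I. \<forall>i. i \<notin> I \<longrightarrow> w i \<bullet> u + d / 3 \<le> w j \<bullet> u"
      unfolding Z_def by (auto simp: not_le intro: less_imp_le)
  qed (use \<open>d > 0\<close> in simp)
qed

text \<open>The points of \<open>S\<close> at distance at least \<open>g\<close> from the contact
  set form a compact set \<open>K\<close> that misses the hyperplane, so the functional stays a
  positive distance away from \<open>c\<close> on \<open>K\<close>.\<close>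

lemma near_supporting_hyperplane:
  fixes a :: "'a::euclidean_space"
  assumes "compact S" "\<And>x. x \<in> S \<Longrightarrow> a \<bullet> x \<le> c" "g > 0"
  obtains d where "d > 0"
    and "\<And>x. x \<in> S \<Longrightarrow> a \<bullet> x \<ge> c - d \<Longrightarrow> \<exists>y \<in> S \<inter> {x. a \<bullet> x = c}. dist x y \<le> g"
proof -
  let ?F = "S \<inter> {x. a \<bullet> x = c}"
  define K where "K = S \<inter> (\<Inter>y\<in>?F. {x. g \<le> dist x y})"
  have "compact K"
    unfolding K_def
    by (intro compact_Int_closed \<open>compact S\<close> closed_INT ballI closed_Collect_le continuous_intros)
  then have "closed ((\<lambda>x. a \<bullet> x) ` K)"
    by (intro compact_imp_closed compact_continuous_image continuous_intros)
  moreover have "c \<notin> (\<lambda>x. a \<bullet> x) ` K"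
    using \<open>g > 0\<close> by (force simp: K_def)
  ultimately obtain d where d: "d > 0" "\<And>y. y \<in> (\<lambda>x. a \<bullet> x) ` K \<Longrightarrow> d \<le> dist c y"
    using separate_point_closed by metis
  show thesis
  proof (rule that[of "d / 2"])
    fix x assume x: "x \<in> S" "a \<bullet> x \<ge> c - d / 2"
    then have "dist c (a \<bullet> x) < d" using \<open>d > 0\<close> assms(2)[of x] by (simp add: dist_real_def)
    then have "x \<notin> K" using d(2) by fastforce
    then obtain y where "y \<in> ?F" "\<not> g \<le> dist x y" using x(1) unfolding K_def by blast
    then show "\<exists>y\<in>?F. dist x y \<le> g" by (intro bexI[of _ y]) auto
  qed (use \<open>d > 0\<close> in simp)
qed

section \<open>Normal projection and the geometry of scaled and thickened polytopes\<close>

text \<open>For an orthonormal \<open>B\<close> this is the orthogonal projection onto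
  \<open>span B\<close>.\<close>

definition basis_proj :: "'a::real_inner set \<Rightarrow> 'a \<Rightarrow> 'a" where
  "basis_proj B u = (\<Sum>v\<in>B. (v \<bullet> u) *\<^sub>R v)"

lemma linear_basis_proj: "linear (basis_proj B)"
  by (rule linearI)
     (simp_all add: basis_proj_def inner_add_right scaleR_add_left sum.distrib scaleR_sum_right)

lemma norm_basis_proj_le:
  assumes "\<And>v. v \<in> B \<Longrightarrow> norm v = 1"
  shows "norm (basis_proj B u) \<le> (\<Sum>v\<in>B. \<bar>v \<bullet> u\<bar>)"
  unfolding basis_proj_def by (rule sum_norm_le) (simp add: assms)

lemma orthonormal_basis_of_finite:
  fixes B :: "(real ^ 'd) set"
  assumes "orthonormal_basis_of B S"
  shows "finite B"
proof (rule independent_imp_finite[OF pairwise_orthogonal_independent])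
  show "pairwise orthogonal B" "0 \<notin> B"
    using assms by (auto simp: orthonormal_basis_of_def)
qed

text \<open>The signs are left open so that one computation covers both the projection
  (\<open>s u = u\<close>) and the points of the cross polytope.\<close>

lemma inner_sum_orthonormal:
  fixes B :: "(real ^ 'd) set"
  assumes "orthonormal_basis_of B S" "v \<in> B" "\<And>u. u \<in> B \<Longrightarrow> s u \<in> {u, - u}"
  shows "v \<bullet> (\<Sum>u\<in>B. k u *\<^sub>R s u) = k v * (v \<bullet> s v)"
proof -
  have "v \<bullet> s u = 0" if "u \<in> B" "u \<noteq> v" for u
  proof -
    have "v \<bullet> u = 0"
      using assms(1,2) that by (auto simp: orthonormal_basis_of_def pairwise_def orthogonal_def)
    then show ?thesis using assms(3)[OF that(1)] by auto
  qed
  then have "(\<Sum>u\<in>B. k u * (v \<bullet> s u)) = (\<Sum>u\<in>B. if u = v then k v * (v \<bullet> s v) else 0)"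
    by (intro sum.cong) auto
  then show ?thesis
    using assms(2) orthonormal_basis_of_finite[OF assms(1)] by (simp add: inner_sum_right)
qed

lemma inner_basis_proj:
  fixes B :: "(real ^ 'd) set"
  assumes "orthonormal_basis_of B S" "v \<in> B"
  shows "v \<bullet> basis_proj B u = v \<bullet> u"
proof -
  have "v \<bullet> v = 1"
    using assms by (simp add: orthonormal_basis_of_def flip: power2_norm_eq_inner)
  then show ?thesis
    unfolding basis_proj_def
    using inner_sum_orthonormal[OF assms, where s = "\<lambda>u. u"] by simp
qed

lemma basis_proj_idem:
  fixes B :: "(real ^ 'd) set"
  assumes "orthonormal_basis_of B S"
  shows "basis_proj B (basis_proj B u) = basis_proj B u"
proof -
  have "basis_proj B (basis_proj B u) = (\<Sum>v\<in>B. (v \<bullet> basis_proj B u) *\<^sub>R v)"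
    by (rule basis_proj_def)
  also have "\<dots> = (\<Sum>v\<in>B. (v \<bullet> u) *\<^sub>R v)"
    by (simp add: inner_basis_proj[OF assms])
  finally show ?thesis by (simp only: basis_proj_def[of B u])
qed

text \<open>The cross polytope is the l1 unit ball of \<open>span B\<close> in the coordinates given
  by \<open>B\<close>: the coefficients and signs of its definition are the absolute values and
  signs of these coordinates.\<close>

lemma cross_polytope_iff:
  fixes B :: "(real ^ 'd) set"
  assumes B: "orthonormal_basis_of B S"
  shows "x \<in> cross_polytope B \<longleftrightarrow> basis_proj B x = x \<and> (\<Sum>v\<in>B. \<bar>v \<bullet> x\<bar>) \<le> 1"
proof
  have unit: "v \<bullet> v = 1" if "v \<in> B" for v
    using B that by (simp add: orthonormal_basis_of_def flip: power2_norm_eq_inner)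
  assume "x \<in> cross_polytope B"
  then obtain k s where x: "x = (\<Sum>v\<in>B. k v *\<^sub>R s v)" and k: "(\<Sum>v\<in>B. k v) \<le> 1"
      "\<And>v. v \<in> B \<Longrightarrow> k v \<ge> 0" and s: "\<And>v. v \<in> B \<Longrightarrow> s v \<in> {v, - v}"
    by (auto simp: cross_polytope_def)
  have vx: "v \<bullet> x = k v * (v \<bullet> s v)" if "v \<in> B" for v
    unfolding x by (rule inner_sum_orthonormal[OF B that s])
  have "(v \<bullet> x) *\<^sub>R v = k v *\<^sub>R s v" "\<bar>v \<bullet> x\<bar> = k v" if "v \<in> B" for v
    using vx[OF that] s[OF that] k(2)[OF that] unit[OF that] by auto
  then show "basis_proj B x = x \<and> (\<Sum>v\<in>B. \<bar>v \<bullet> x\<bar>) \<le> 1"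
    using k(1) by (simp add: basis_proj_def x)
next
  assume x: "basis_proj B x = x \<and> (\<Sum>v\<in>B. \<bar>v \<bullet> x\<bar>) \<le> 1"
  have "x = (\<Sum>v\<in>B. \<bar>v \<bullet> x\<bar> *\<^sub>R (if v \<bullet> x \<ge> 0 then v else - v))"
    by (subst conjunct1[OF x, symmetric], unfold basis_proj_def, rule sum.cong) auto
  then show "x \<in> cross_polytope B"
    unfolding cross_polytope_def using x
    by (intro CollectI exI[of _ "\<lambda>v. \<bar>v \<bullet> x\<bar>"] exI[of _ "\<lambda>v. if v \<bullet> x \<ge> 0 then v else - v"]) auto
qed

lemma affine_orthogonal_inner_eq:
  assumes "v \<in> affine_orthogonal P" "x \<in> affine hull P" "y \<in> affine hull P"
  shows "v \<bullet> x = v \<bullet> y"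
proof -
  have "orthogonal v (x - y)" using assms by (simp add: affine_orthogonal_def)
  then show ?thesis by (simp add: orthogonal_def inner_diff_right)
qed

lemma orthonormal_basis_of_inner_eq:
  assumes "orthonormal_basis_of B (affine_orthogonal P)" "v \<in> B"
    "x \<in> affine hull P" "y \<in> affine hull P"
  shows "v \<bullet> x = v \<bullet> y"
proof -
  have "v \<in> affine_orthogonal P"
    using assms(1) span_base[OF assms(2)] by (simp add: orthonormal_basis_of_def)
  then show ?thesis using assms(3,4) by (rule affine_orthogonal_inner_eq)
qed

text \<open>What remains after removing the normal part is orthogonal to the orthogonal complement
  of the direction space, and a subspace equals its double complement.\<close>

lemma minus_basis_proj_in_affine_hull:
  fixes P :: "(real ^ 'd) set"
  assumes B: "orthonormal_basis_of B (affine_orthogonal P)" and b: "b \<in> affine hull P"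
  shows "x - basis_proj B (x - b) \<in> affine hull P"
proof -
  let ?D = "(\<lambda>y. y - b) ` (affine hull P)"
  have sub: "subspace ?D"
    by (intro affine_diffs_subspace_subtract b) simp
  have D_eq: "affine_orthogonal P = ?D\<^sup>\<bottom>"
  proof -
    have "orthogonal v (y - z)" if "\<forall>u\<in>?D. orthogonal u v" "y \<in> affine hull P" "z \<in> affine hull P" for v y z
    proof -
      have "orthogonal (y - b) v" "orthogonal (z - b) v" using that by auto
      then show ?thesis by (simp add: orthogonal_def inner_diff_left inner_diff_right inner_commute)
    qed
    then show ?thesis
      using b by (auto simp: affine_orthogonal_def orthogonal_comp_def orthogonal_commute)
  qed
  have "x - b - basis_proj B (x - b) \<in> ?D\<^sup>\<bottom>\<^sup>\<bottom>"
  proof -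
    have "orthogonal u (x - b - basis_proj B (x - b))" if "u \<in> span B" for u
    proof (rule orthogonal_to_span[OF that, THEN orthogonal_commute[THEN iffD1]])
      fix v assume "v \<in> B"
      then show "orthogonal (x - b - basis_proj B (x - b)) v"
        using inner_basis_proj[OF B, of v "x - b"]
        by (simp add: orthogonal_def inner_commute[of _ v] inner_diff_right)
    qed
    moreover have "span B = ?D\<^sup>\<bottom>" using B D_eq by (simp add: orthonormal_basis_of_def)
    ultimately show ?thesis by (auto simp: orthogonal_comp_def)
  qed
  then have "x - b - basis_proj B (x - b) \<in> ?D" by (simp add: orthogonal_comp_self[OF sub])
  then obtain y where "y \<in> affine hull P" "x - b - basis_proj B (x - b) = y - b" by auto
  moreover from this(2) have "x - basis_proj B (x - b) = y" by (simp add: algebra_simps)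
  ultimately show ?thesis by simp
qed

lemma scaled_polytope_subset:
  assumes "convex P" "vertex_mean P \<in> P" "0 \<le> \<eta>" "\<eta> \<le> 1"
  shows "scaled_polytope P \<eta> \<subseteq> P"
proof -
  have "\<eta> *\<^sub>R x + (1 - \<eta>) *\<^sub>R vertex_mean P \<in> P" if "x \<in> P" for x
    by (rule convexD[OF assms(1) that assms(2)]) (use assms in auto)
  then show ?thesis
    by (auto simp: scaled_polytope_def algebra_simps)
qed

text \<open>Shrinking about the vertex mean pushes each facet inequality inwards by the fraction
  \<open>1 - \<eta>\<close> of the slack that the vertex mean has there.\<close>

lemma scaled_polytope_iff:
  fixes P :: "(real ^ 'd) set"
  assumes P: "P = affine hull P \<inter> {x. \<forall>h\<in>H. a h \<bullet> x \<le> c h}"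
    and b: "vertex_mean P \<in> affine hull P" and "\<eta> > 0"
  shows "y \<in> scaled_polytope P \<eta> \<longleftrightarrow> y \<in> affine hull P \<and>
     (\<forall>h\<in>H. a h \<bullet> y \<le> c h - (1 - \<eta>) * (c h - a h \<bullet> vertex_mean P))"
proof -
  let ?b = "vertex_mean P"
  \<comment> \<open>\<open>z\<close> is the preimage of \<open>y\<close> under the
    homothety.\<close>
  define z where "z = ?b + (1 / \<eta>) *\<^sub>R (y - ?b)"
  have y: "y = \<eta> *\<^sub>R (z - ?b) + ?b" using \<open>\<eta> > 0\<close> by (simp add: z_def)
  have half: "a h \<bullet> z \<le> c h \<longleftrightarrow> a h \<bullet> y \<le> c h - (1 - \<eta>) * (c h - a h \<bullet> ?b)" for h
  proof -
    have "a h \<bullet> y = \<eta> * (a h \<bullet> z) + (1 - \<eta>) * (a h \<bullet> ?b)"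
      by (subst y) (simp add: inner_add_right inner_diff_right algebra_simps)
    moreover have "a h \<bullet> z \<le> c h \<longleftrightarrow> \<eta> * (a h \<bullet> z) \<le> \<eta> * c h" using \<open>\<eta> > 0\<close> by simp
    ultimately show ?thesis by (simp add: algebra_simps)
  qed
  have "y \<in> scaled_polytope P \<eta> \<longleftrightarrow> z \<in> P"
  proof
    assume "y \<in> scaled_polytope P \<eta>"
    then obtain x where "x \<in> P" "y = \<eta> *\<^sub>R (x - ?b) + ?b"
      by (auto simp: scaled_polytope_def)
    then show "z \<in> P" using \<open>\<eta> > 0\<close> by (simp add: z_def)
  qed (use y in \<open>auto simp: scaled_polytope_def\<close>)
  also have "\<dots> \<longleftrightarrow> z \<in> affine hull P \<and> (\<forall>h\<in>H. a h \<bullet> z \<le> c h)"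
    by (subst P) simp
  also have "z \<in> affine hull P \<longleftrightarrow> y \<in> affine hull P"
  proof
    assume "z \<in> affine hull P"
    then show "y \<in> affine hull P"
      using mem_affine_3_minus[OF affine_affine_hull b _ b, of z \<eta>] y by (simp add: add.commute)
  next
    assume "y \<in> affine hull P"
    then show "z \<in> affine hull P"
      unfolding z_def by (rule mem_affine_3_minus[OF affine_affine_hull b _ b])
  qed
  finally show ?thesis by (simp only: half)
qed

text \<open>Membership decouples into a condition on the tangential part and one on the normal part.
  Any base point \<open>b\<close> of the affine hull will do, because vectors of \<open>B\<close>
  have constant inner product there.\<close>

lemma thickened_polytope_iff:
  fixes P :: "(real ^ 'd) set"
  assumes B: "orthonormal_basis_of B (affine_orthogonal P)" and b: "b \<in> affine hull P"
    and sub: "scaled_polytope P \<eta> \<subseteq> affine hull P" and "\<epsilon> > 0"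
  shows "x \<in> thickened_polytope P B \<eta> \<epsilon> \<longleftrightarrow>
    x - basis_proj B (x - b) \<in> scaled_polytope P \<eta> \<and> (\<Sum>v\<in>B. \<bar>v \<bullet> (x - b)\<bar>) \<le> \<epsilon>"
proof
  assume "x \<in> thickened_polytope P B \<eta> \<epsilon>"
  then obtain p c where x: "x = p + \<epsilon> *\<^sub>R c" and p: "p \<in> scaled_polytope P \<eta>"
      and c: "basis_proj B c = c" "(\<Sum>v\<in>B. \<bar>v \<bullet> c\<bar>) \<le> 1"
    by (auto simp: thickened_polytope_def cross_polytope_iff[OF B])
  have vx: "v \<bullet> (x - b) = \<epsilon> * (v \<bullet> c)" if "v \<in> B" for v
    using orthonormal_basis_of_inner_eq[OF B that _ b, of p] p sub
    by (auto simp: x inner_add_right inner_diff_right)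
  have "basis_proj B (x - b) = basis_proj B (\<epsilon> *\<^sub>R c)"
    unfolding basis_proj_def by (intro sum.cong) (simp_all add: vx)
  also have "\<dots> = \<epsilon> *\<^sub>R c"
    using c(1) by (simp add: linear_scale[OF linear_basis_proj])
  finally have "x - basis_proj B (x - b) = p" by (simp add: x)
  moreover have "(\<Sum>v\<in>B. \<bar>v \<bullet> (x - b)\<bar>) = \<epsilon> * (\<Sum>v\<in>B. \<bar>v \<bullet> c\<bar>)"
    using \<open>\<epsilon> > 0\<close> by (simp add: vx abs_mult sum_distrib_left)
  ultimately show "x - basis_proj B (x - b) \<in> scaled_polytope P \<eta> \<and> (\<Sum>v\<in>B. \<bar>v \<bullet> (x - b)\<bar>) \<le> \<epsilon>"
    using p c(2) \<open>\<epsilon> > 0\<close> by (simp add: mult_left_le)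
next
  assume *: "x - basis_proj B (x - b) \<in> scaled_polytope P \<eta> \<and> (\<Sum>v\<in>B. \<bar>v \<bullet> (x - b)\<bar>) \<le> \<epsilon>"
  define c where "c = (1 / \<epsilon>) *\<^sub>R basis_proj B (x - b)"
  have "basis_proj B c = c"
    by (simp add: c_def linear_scale[OF linear_basis_proj] basis_proj_idem[OF B])
  moreover have "(\<Sum>v\<in>B. \<bar>v \<bullet> c\<bar>) = (\<Sum>v\<in>B. \<bar>v \<bullet> (x - b)\<bar>) / \<epsilon>"
    using \<open>\<epsilon> > 0\<close> by (simp add: c_def inner_basis_proj[OF B] abs_mult sum_divide_distrib)
  ultimately have "c \<in> cross_polytope B"
    using * \<open>\<epsilon> > 0\<close> by (simp add: cross_polytope_iff[OF B])
  moreover have "x = (x - basis_proj B (x - b)) + \<epsilon> *\<^sub>R c" using \<open>\<epsilon> > 0\<close> by (simp add: c_def)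
  ultimately show "x \<in> thickened_polytope P B \<eta> \<epsilon>"
    unfolding thickened_polytope_def using * by blast
qed

text \<open>A point may be reassembled from a new tangential part \<open>z\<close> and an old normal
  part without disturbing its normal coordinates.\<close>

lemma basis_proj_plus_affine:
  fixes P :: "(real ^ 'd) set"
  assumes B: "orthonormal_basis_of B (affine_orthogonal P)"
    and "b \<in> affine hull P" "z \<in> affine hull P"
  shows "v \<in> B \<Longrightarrow> v \<bullet> (z + basis_proj B u - b) = v \<bullet> u"
    and "basis_proj B (z + basis_proj B u - b) = basis_proj B u"
proof -
  show *: "v \<bullet> (z + basis_proj B u - b) = v \<bullet> u" if "v \<in> B" for v
    using orthonormal_basis_of_inner_eq[OF B that assms(3,2)] inner_basis_proj[OF B that, of u]
    by (simp add: inner_diff_right inner_add_right)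
  show "basis_proj B (z + basis_proj B u - b) = basis_proj B u"
    by (subst basis_proj_def, subst basis_proj_def[of B u], rule sum.cong) (simp_all only: *)
qed

lemma scaled_polytope_affinity:
  "scaled_polytope P \<eta> = (\<lambda>x. (1 - \<eta>) *\<^sub>R vertex_mean P + \<eta> *\<^sub>R x) ` P"
  unfolding scaled_polytope_def by (intro image_cong) (auto simp: algebra_simps)

lemma convex_thickened_polytope:
  fixes P :: "(real ^ 'd) set"
  assumes B: "orthonormal_basis_of B (affine_orthogonal P)" and b: "b \<in> affine hull P"
    and sub: "scaled_polytope P \<eta> \<subseteq> affine hull P" and "\<epsilon> > 0" and "convex P"
  shows "convex (thickened_polytope P B \<eta> \<epsilon>)"
proof (rule convexI)
  fix x y and s t :: real
  assume x: "x \<in> thickened_polytope P B \<eta> \<epsilon>" and y: "y \<in> thickened_polytope P B \<eta> \<epsilon>"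
    and st: "0 \<le> s" "0 \<le> t" "s + t = 1"
  note iff = thickened_polytope_iff[OF B b sub \<open>\<epsilon> > 0\<close>]
  have b_eq: "b = s *\<^sub>R b + t *\<^sub>R b" using st by (simp flip: scaleR_left.add)
  have eq: "s *\<^sub>R x + t *\<^sub>R y - b = s *\<^sub>R (x - b) + t *\<^sub>R (y - b)"
    by (subst b_eq) (simp add: algebra_simps)
  have "s *\<^sub>R x + t *\<^sub>R y - basis_proj B (s *\<^sub>R x + t *\<^sub>R y - b)
      = s *\<^sub>R (x - basis_proj B (x - b)) + t *\<^sub>R (y - basis_proj B (y - b))"
    unfolding eq linear_add[OF linear_basis_proj] linear_scale[OF linear_basis_proj]
    by (simp add: scaleR_diff_right)
  moreover have "convex (scaled_polytope P \<eta>)"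
    unfolding scaled_polytope_affinity by (rule convex_affinity[OF \<open>convex P\<close>])
  ultimately have "s *\<^sub>R x + t *\<^sub>R y - basis_proj B (s *\<^sub>R x + t *\<^sub>R y - b) \<in> scaled_polytope P \<eta>"
    using x y st by (simp add: iff convexD)
  moreover have "(\<Sum>v\<in>B. \<bar>v \<bullet> (s *\<^sub>R x + t *\<^sub>R y - b)\<bar>) \<le> \<epsilon>"
  proof -
    have "(\<Sum>v\<in>B. \<bar>v \<bullet> (s *\<^sub>R x + t *\<^sub>R y - b)\<bar>)
        \<le> (\<Sum>v\<in>B. s * \<bar>v \<bullet> (x - b)\<bar> + t * \<bar>v \<bullet> (y - b)\<bar>)"
      unfolding eq inner_add_right inner_scaleR_right using st
      by (intro sum_mono order_trans[OF abs_triangle_ineq]) (simp add: abs_mult)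
    also have "\<dots> = s * (\<Sum>v\<in>B. \<bar>v \<bullet> (x - b)\<bar>) + t * (\<Sum>v\<in>B. \<bar>v \<bullet> (y - b)\<bar>)"
      by (simp add: sum.distrib sum_distrib_left)
    also have "\<dots> \<le> s * \<epsilon> + t * \<epsilon>"
      using x y st by (intro add_mono mult_left_mono) (auto simp: iff)
    also have "\<dots> = \<epsilon>" using st by (simp flip: distrib_right)
    finally show ?thesis .
  qed
  ultimately show "s *\<^sub>R x + t *\<^sub>R y \<in> thickened_polytope P B \<eta> \<epsilon>" by (simp add: iff)
qed

lemma compact_thickened_polytope:
  fixes P :: "(real ^ 'd) set"
  assumes B: "orthonormal_basis_of B (affine_orthogonal P)" and b: "b \<in> affine hull P"
    and sub: "scaled_polytope P \<eta> \<subseteq> affine hull P" and "\<epsilon> > 0" and "compact P"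
  shows "compact (thickened_polytope P B \<eta> \<epsilon>)"
proof -
  let ?T = "thickened_polytope P B \<eta> \<epsilon>" and ?L = "\<lambda>x. x - basis_proj B (x - b)"
  note iff = thickened_polytope_iff[OF B b sub \<open>\<epsilon> > 0\<close>]
  have comp: "compact (scaled_polytope P \<eta>)"
    unfolding scaled_polytope_affinity by (rule compact_affinity[OF \<open>compact P\<close>])
  have cont: "continuous_on UNIV ?L"
    unfolding basis_proj_def by (intro continuous_intros)
  have "?T = ?L -` scaled_polytope P \<eta> \<inter> {x. (\<Sum>v\<in>B. \<bar>v \<bullet> (x - b)\<bar>) \<le> \<epsilon>}"
    by (auto simp: iff)
  moreover have "closed (?L -` scaled_polytope P \<eta>)"
    by (rule continuous_closed_vimage[OF compact_imp_closed[OF comp]])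
       (use cont in \<open>auto simp: continuous_on_eq_continuous_at\<close>)
  moreover have "closed {x. (\<Sum>v\<in>B. \<bar>v \<bullet> (x - b)\<bar>) \<le> \<epsilon>}"
    by (intro closed_Collect_le continuous_intros)
  ultimately have "closed ?T" by (simp add: closed_Int)
  moreover have "bounded ?T"
  proof -
    obtain R where R: "\<And>y. y \<in> scaled_polytope P \<eta> \<Longrightarrow> norm y \<le> R"
      using compact_imp_bounded[OF comp] by (auto simp: bounded_iff)
    have "norm x \<le> R + \<epsilon>" if "x \<in> ?T" for x
    proof -
      have "norm x \<le> norm (?L x) + norm (basis_proj B (x - b))"
        using norm_triangle_ineq[of "?L x" "basis_proj B (x - b)"] by simp
      moreover have "norm (basis_proj B (x - b)) \<le> (\<Sum>v\<in>B. \<bar>v \<bullet> (x - b)\<bar>)"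
        by (rule norm_basis_proj_le) (use B in \<open>simp add: orthonormal_basis_of_def\<close>)
      ultimately show ?thesis using that R[of "?L x"] by (simp add: iff)
    qed
    then show ?thesis by (auto simp: bounded_iff)
  qed
  ultimately show ?thesis by (simp add: compact_eq_bounded_closed)
qed

text \<open>The tangential part of the displacement points out of the scaled polytope, so Brouwer's
  theorem is applied after reversing it; this does not change the fixed points.\<close>

lemma fixed_point_thickened_polytope:
  fixes P :: "(real ^ 'd) set"
  assumes B: "orthonormal_basis_of B (affine_orthogonal P)" and b: "b \<in> affine hull P"
    and sub: "scaled_polytope P \<eta> \<subseteq> affine hull P" and "\<epsilon> > 0"
    and P: "compact P" "convex P" and bP: "b \<in> scaled_polytope P \<eta>"
    and f: "continuous_on (thickened_polytope P B \<eta> \<epsilon>) f" and "t > 0"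
    and normal: "\<And>x. x \<in> thickened_polytope P B \<eta> \<epsilon> \<Longrightarrow> (\<Sum>v\<in>B. \<bar>v \<bullet> (f x - b)\<bar>) \<le> \<epsilon>"
    and tangential: "\<And>x. x \<in> thickened_polytope P B \<eta> \<epsilon> \<Longrightarrow>
      x - basis_proj B (x - b) + t *\<^sub>R (x - basis_proj B (x - b) - (f x - basis_proj B (f x - b)))
        \<in> scaled_polytope P \<eta>"
  obtains x where "x \<in> thickened_polytope P B \<eta> \<epsilon>" "f x = x"
proof -
  let ?T = "thickened_polytope P B \<eta> \<epsilon>"
  note iff = thickened_polytope_iff[OF B b sub \<open>\<epsilon> > 0\<close>]
  define L where "L x = x - basis_proj B (x - b)" for x
  define z where "z x = L x + t *\<^sub>R (L x - L (f x))" for x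
  \<comment> \<open>\<open>h\<close> takes its normal part from \<open>f x\<close> and its
    tangential part from \<open>z x\<close>, so the two hypotheses on \<open>f\<close> control the
    two membership conditions separately.\<close>
  define h where "h x = z x + basis_proj B (f x - b)" for x
  have z: "z x \<in> scaled_polytope P \<eta>" if "x \<in> ?T" for x
    using tangential[OF that] by (simp add: z_def L_def)
  have vh: "v \<bullet> (h x - b) = v \<bullet> (f x - b)" if "x \<in> ?T" "v \<in> B" for x v
    unfolding h_def using basis_proj_plus_affine(1)[OF B b, of "z x" v "f x - b"] z[OF that(1)] sub that(2)
    by blast
  have ph: "basis_proj B (h x - b) = basis_proj B (f x - b)" if "x \<in> ?T" for x
    unfolding h_def using basis_proj_plus_affine(2)[OF B b, of "z x" "f x - b"] z[OF that(1)] sub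
    by blast
  have "h x \<in> ?T" if "x \<in> ?T" for x
    using z[OF that] normal[OF that] by (simp add: iff ph[OF that] vh[OF that]) (simp add: h_def)
  moreover have "b \<in> ?T"
    using bP \<open>\<epsilon> > 0\<close> by (simp add: iff linear_0[OF linear_basis_proj])
  moreover have "continuous_on ?T h"
    unfolding h_def z_def L_def basis_proj_def by (intro continuous_intros f)
  ultimately obtain x where x: "x \<in> ?T" "h x = x"
    using brouwer[of ?T h] compact_thickened_polytope[OF B b sub \<open>\<epsilon> > 0\<close> P(1)]
      convex_thickened_polytope[OF B b sub \<open>\<epsilon> > 0\<close> P(2)] by blast
  have p: "basis_proj B (x - b) = basis_proj B (f x - b)"
    using ph[OF x(1)] x(2) by simp
  \<comment> \<open>The normal parts of \<open>x\<close> and \<open>f x\<close> agree, so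
    \<open>h x = x\<close> leaves only the tangential equation, in which \<open>t\<close> times
    \<open>L x - L (f x)\<close> must vanish.\<close>
  then have "L x = z x" using x(2) by (simp add: L_def h_def diff_eq_eq)
  then have "L x = L (f x)" using \<open>t > 0\<close> by (simp add: z_def)
  then have "f x = x" using p by (simp add: L_def)
  with x(1) show thesis by (rule that)
qed

section \<open>Vertices and the vertex mean\<close>

lemma extreme_points_convex_hull:
  fixes S :: "(real ^ 'd) set"
  assumes "finite S" "S \<noteq> {}"
  defines "E \<equiv> {x. x extreme_point_of (convex hull S)}"
  shows "E \<subseteq> S" "finite E" "E \<noteq> {}" "convex hull E = convex hull S"
proof -
  show "E \<subseteq> S" unfolding E_def by (rule extreme_points_of_convex_hull)
  then show "finite E" using assms(1) finite_subset by blast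
  show eq: "convex hull E = convex hull S"
    unfolding E_def using Krein_Milman_polytope[OF assms(1)] by simp
  show "E \<noteq> {}"
    using eq assms(2) convex_hull_eq_empty[of E] convex_hull_eq_empty[of S] by blast
qed

lemma vertex_mean_convex_hull:
  fixes S :: "(real ^ 'd) set"
  assumes S: "finite S" "S \<noteq> {}"
  shows "vertex_mean (convex hull S) \<in> convex hull S"
proof -
  define E where "E = {x. x extreme_point_of (convex hull S)}"
  note E = extreme_points_convex_hull[OF S, folded E_def]
  have "vertex_mean (convex hull S) = (\<Sum>x\<in>E. (1 / real (card E)) *\<^sub>R x)"
    by (simp add: vertex_mean_def E_def scaleR_sum_right divide_inverse)
  also have "\<dots> \<in> convex hull E"
    by (rule convex_sum) (use E in \<open>auto simp: hull_inc\<close>)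
  finally show ?thesis using E(4) by simp
qed

lemma inner_vertex_mean:
  "real (card {x. x extreme_point_of P}) * (a \<bullet> vertex_mean P) = (\<Sum>x | x extreme_point_of P. a \<bullet> x)"
  if "finite {x. x extreme_point_of P}" "{x. x extreme_point_of P} \<noteq> {}"
proof -
  have "real (card {x. x extreme_point_of P}) \<noteq> 0" using that by (simp add: card_eq_0_iff)
  then show ?thesis
    by (simp add: vertex_mean_def inner_sum_right)
qed

text \<open>If all vertices lay on the hyperplane, so would their hull. Hence some vertex has strict
  slack, and the mean, weighting every vertex positively, inherits it.\<close>

lemma inner_vertex_mean_less:
  fixes S :: "(real ^ 'd) set"
  assumes S: "finite S" "S \<noteq> {}" and le: "\<And>x. x \<in> convex hull S \<Longrightarrow> a \<bullet> x \<le> c"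
    and y: "y \<in> convex hull S" "a \<bullet> y \<noteq> c"
  shows "a \<bullet> vertex_mean (convex hull S) < c"
proof -
  define E where "E = {x. x extreme_point_of (convex hull S)}"
  note E = extreme_points_convex_hull[OF S, folded E_def]
  have leE: "a \<bullet> x \<le> c" if "x \<in> E" for x
    using le[of x] that E(1) by (auto intro: hull_inc)
  obtain e where e: "e \<in> E" "a \<bullet> e \<noteq> c"
  proof (rule ccontr)
    assume "\<not> thesis"
    then have "E \<subseteq> {x. a \<bullet> x = c}" using that by blast
    then have "convex hull E \<subseteq> {x. a \<bullet> x = c}" by (rule hull_minimal) (rule convex_hyperplane)
    then show False using y E(4) by blast
  qed
  have "0 < (\<Sum>x\<in>E. c - a \<bullet> x)"
    by (rule sum_pos2[OF E(2) e(1)]) (use leE e in \<open>auto simp: less_le\<close>)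
  also have "\<dots> = real (card E) * (c - a \<bullet> vertex_mean (convex hull S))"
    using inner_vertex_mean[of "convex hull S" a] E(2,3)
    by (simp add: sum_subtractf E_def algebra_simps)
  finally show ?thesis using E by (simp add: zero_less_mult_iff)
qed

text \<open>For unit vectors with mean \<open>b\<close>, the squared distances to \<open>b\<close>
  sum to their number times \<open>1 - b \<bullet> b\<close>. This is positive because some vertex
  differs from \<open>b\<close>.\<close>

lemma norm_vertex_mean_less:
  fixes S :: "(real ^ 'd) set"
  assumes S: "finite S" and unit: "\<And>x. x \<in> S \<Longrightarrow> norm x = 1" and "card S > 1"
  shows "norm (vertex_mean (convex hull S)) < 1"
proof -
  have S': "S \<noteq> {}" using \<open>card S > 1\<close> by auto
  define b where "b = vertex_mean (convex hull S)"
  define E where "E = {x. x extreme_point_of (convex hull S)}"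
  note E = extreme_points_convex_hull[OF S S', folded E_def]
  obtain e where e: "e \<in> E" "e \<noteq> b"
  proof (rule ccontr)
    assume "\<not> thesis"
    then have "E \<subseteq> {b}" using that by blast
    then have "convex hull S \<subseteq> {b}" using hull_mono[of E "{b}" convex] E(4) by simp
    then have "S \<subseteq> {b}" using hull_subset[of S convex] by (rule order_trans[rotated])
    then show False using \<open>card S > 1\<close> card_mono[of "{b}" S] by simp
  qed
  have "0 < (\<Sum>x\<in>E. (x - b) \<bullet> (x - b))"
    by (rule sum_pos2[OF E(2) e(1)]) (use e in auto)
  also have "\<dots> = (\<Sum>x\<in>E. 1 - 2 * (b \<bullet> x) + b \<bullet> b)"
  proof (rule sum.cong)
    fix x assume "x \<in> E"
    then have "x \<bullet> x = 1" using unit E(1) by (auto simp flip: power2_norm_eq_inner)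
    then show "(x - b) \<bullet> (x - b) = 1 - 2 * (b \<bullet> x) + b \<bullet> b"
      by (simp add: inner_diff_left inner_diff_right inner_commute)
  qed simp
  also have "\<dots> = real (card E) * (1 - b \<bullet> b)"
    using inner_vertex_mean[of "convex hull S" b] E(2,3)
    by (simp add: sum.distrib sum_subtractf E_def b_def algebra_simps flip: sum_distrib_left)
  finally have "b \<bullet> b < 1" using E by (simp add: zero_less_mult_iff)
  then show ?thesis by (simp add: b_def norm_lt_square flip: power2_norm_eq_inner)
qed

text \<open>By Minkowski's theorem a face is the hull of its vertices. Thus CIPS for the vertex
  indices speaks about every point of the face.\<close>

lemma convex_hull_vertex_indices:
  fixes w :: "'n::finite \<Rightarrow> real ^ 'd"
  assumes "F face_of convex hull (w ` J)"
  shows "convex hull (w ` vertex_indices w J F) = F"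
proof -
  let ?P = "convex hull (w ` J)"
  have "compact ?P" by (intro compact_convex_hull finite_imp_compact) auto
  then have "compact F" using face_of_imp_compact[OF _ _ assms] by simp
  moreover have "convex F" using face_of_imp_convex[OF assms] by simp
  moreover have "{x. x extreme_point_of F} = w ` vertex_indices w J F"
    using extreme_point_of_face[OF assms] extreme_point_of_convex_hull[of _ "w ` J"]
    by (auto simp: vertex_indices_def)
  ultimately show ?thesis using Krein_Milman_Minkowski[of F] by simp
qed

text \<open>Each of the finitely many conditions holds for all small positive \<open>s\<close>. This
  yields both the amount of shrinking and the step size in the final proof.\<close>

lemma finite_uniform_scale:
  fixes m d :: "'a \<Rightarrow> real"
  assumes "finite H" "\<And>h. h \<in> H \<Longrightarrow> d h > 0"
  obtains s where "0 < s" "s < 1" "\<And>h. h \<in> H \<Longrightarrow> s * m h < d h"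
proof -
  have "eventually (\<lambda>s. s * m h < d h) (at_right 0)" if "h \<in> H" for h
  proof (rule order_tendstoD(2)[OF _ assms(2)[OF that]])
    show "((\<lambda>s. s * m h) \<longlongrightarrow> 0) (at_right 0)"
      by (auto intro!: tendsto_eq_intros)
  qed
  then have "eventually (\<lambda>s. \<forall>h\<in>H. s * m h < d h) (at_right 0)"
    using assms(1) by (simp add: eventually_ball_finite)
  moreover have "eventually (\<lambda>s::real. s \<in> {0<..<1}) (at_right 0)"
    by (rule eventually_at_right_real) simp
  ultimately have "eventually (\<lambda>s. s \<in> {0<..<1} \<and> (\<forall>h\<in>H. s * m h < d h)) (at_right 0)"
    by eventually_elim simp
  then obtain s where "s \<in> {0<..<1} \<and> (\<forall>h\<in>H. s * m h < d h)"
    using eventually_happens[of _ "at_right (0::real)"] trivial_limit_at_right_real by blast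
  then show thesis using that by auto
qed

section \<open>Facet inequalities and the gap near a facet\<close>

text \<open>In an irredundant system of half-spaces every bounding hyperplane cuts out a facet. The
  last clause chooses the normals parallel to the affine hull.\<close>

lemma polytope_facet_representation:
  fixes S :: "'a::euclidean_space set"
  assumes "polytope S"
  obtains H :: "'a set set" and a c where "finite H"
    and "S = affine hull S \<inter> {x. \<forall>h\<in>H. a h \<bullet> x \<le> c h}"
    and "\<And>h. h \<in> H \<Longrightarrow> S \<inter> {x. a h \<bullet> x = c h} facet_of S"
    and "\<And>h x. h \<in> H \<Longrightarrow> x \<in> affine hull S \<Longrightarrow> x + a h \<in> affine hull S"
proof -
  obtain H where H: "finite H" "S = affine hull S \<inter> \<Inter>H"
      and half: "\<forall>h\<in>H. \<exists>a b. a \<noteq> 0 \<and> h = {x. a \<bullet> x \<le> b} \<and>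
                   (\<forall>x \<in> affine hull S. (x + a) \<in> affine hull S)"
      and minimal: "\<forall>H'. H' \<subset> H \<longrightarrow> S \<subset> affine hull S \<inter> \<Inter>H'"
    using polytope_imp_polyhedron[OF assms] unfolding polyhedron_Int_affine_parallel_minimal by blast
  obtain a c where ac: "\<And>h. h \<in> H \<Longrightarrow> a h \<noteq> 0 \<and> h = {x. a h \<bullet> x \<le> c h} \<and>
                   (\<forall>x \<in> affine hull S. (x + a h) \<in> affine hull S)"
    using half by metis
  have "\<Inter>H = {x. \<forall>h\<in>H. a h \<bullet> x \<le> c h}"
    using ac by blast
  moreover have "S \<inter> {x. a h \<bullet> x = c h} facet_of S" if "h \<in> H" for h
    using facet_of_polyhedron_explicit[of H S a c "S \<inter> {x. a h \<bullet> x = c h}"] H ac minimal that by blast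
  ultimately show thesis using that[of H a c] H ac by simp
qed

text \<open>Points of \<open>P\<close> in a thin layer below the facet are close to it, so the CIPS
  gap of the facet reaches them and their neighbours. The competitors are those with
  \<open>a \<bullet> w i \<noteq> c\<close>, since patterns on the hyperplane cause no error in
  \<open>inner_hopfield_close\<close>.\<close>

lemma facet_gap:
  fixes w :: "'n::finite \<Rightarrow> real ^ 'd" and J :: "'n set"
  defines "P \<equiv> convex hull (w ` J)"
  assumes le: "\<And>x. x \<in> P \<Longrightarrow> a \<bullet> x \<le> c" and facet: "P \<inter> {x. a \<bullet> x = c} facet_of P"
    and CIPS: "CIPS w (vertex_indices w J (P \<inter> {x. a \<bullet> x = c}))"
  obtains g d where "g > 0" "d > 0"
    and "\<And>x p. p \<in> P \<Longrightarrow> a \<bullet> p \<ge> c - d \<Longrightarrow> dist x p \<le> g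
       \<Longrightarrow> \<exists>j. a \<bullet> w j = c \<and> (\<forall>i. a \<bullet> w i \<noteq> c \<longrightarrow> w i \<bullet> x + g \<le> w j \<bullet> x)"
proof -
  let ?F = "P \<inter> {x. a \<bullet> x = c}"
  let ?I = "vertex_indices w J ?F"
  have hull: "convex hull (w ` ?I) = ?F"
    unfolding P_def
    by (rule convex_hull_vertex_indices[OF facet_of_imp_face_of[OF facet[unfolded P_def]]])
  have I: "a \<bullet> w j = c" if "j \<in> ?I" for j
    using that by (auto simp: vertex_indices_def extreme_point_of_def)
  obtain g where g: "g > 0" "\<And>u v. v \<in> ?F \<Longrightarrow> dist u v \<le> g
           \<Longrightarrow> \<exists>j\<in>?I. \<forall>i. i \<notin> ?I \<longrightarrow> w i \<bullet> u + g \<le> w j \<bullet> u"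
    using CIPS_uniform_gap[OF CIPS] unfolding hull by blast
  have "compact P" unfolding P_def by (intro compact_convex_hull finite_imp_compact) auto
  then obtain d where d: "d > 0"
      "\<And>x. x \<in> P \<Longrightarrow> a \<bullet> x \<ge> c - d \<Longrightarrow> \<exists>y \<in> ?F. dist x y \<le> g / 2"
    using near_supporting_hyperplane[of P a c "g / 2"] le \<open>g > 0\<close> by auto
  show thesis
  proof (rule that[of "g / 2" d])
    fix x p assume p: "p \<in> P" "a \<bullet> p \<ge> c - d" "dist x p \<le> g / 2"
    obtain y where y: "y \<in> ?F" "dist p y \<le> g / 2" using d(2)[OF p(1,2)] by blast
    have "dist x y \<le> g" using dist_triangle[of x y p] p(3) y(2) by simp
    then obtain j where j: "j \<in> ?I" "\<forall>i. i \<notin> ?I \<longrightarrow> w i \<bullet> x + g \<le> w j \<bullet> x"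
      using g(2)[OF y(1)] by blast
    have "w i \<bullet> x + g / 2 \<le> w j \<bullet> x" if "a \<bullet> w i \<noteq> c" for i
    proof -
      have "w i \<bullet> x + g \<le> w j \<bullet> x" using j(2) I that by blast
      then show ?thesis using \<open>g > 0\<close> by simp
    qed
    then show "\<exists>j. a \<bullet> w j = c \<and> (\<forall>i. a \<bullet> w i \<noteq> c \<longrightarrow> w i \<bullet> x + g / 2 \<le> w j \<bullet> x)"
      using I[OF j(1)] by blast
  qed (use g d in auto)
qed

lemma eventually_scaled_exp_le:
  fixes K g m :: real
  assumes "g > 0" "m > 0"
  shows "eventually (\<lambda>\<beta>. K * exp (- \<beta> * g) \<le> m) at_top"
proof -
  have "filterlim (\<lambda>\<beta>. g * \<beta>) at_top at_top"
    by (rule filterlim_tendsto_pos_mult_at_top[OF tendsto_const \<open>g > 0\<close> filterlim_ident])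
  then have "filterlim (\<lambda>\<beta>. - (g * \<beta>)) at_bot at_top"
    by (simp add: filterlim_uminus_at_bot)
  then have "((\<lambda>\<beta>. K * exp (- (g * \<beta>))) \<longlongrightarrow> K * 0) at_top"
    by (intro tendsto_mult tendsto_const filterlim_compose[OF exp_at_bot])
  then have "eventually (\<lambda>\<beta>. K * exp (- (g * \<beta>)) < m) at_top"
    using \<open>m > 0\<close> by (intro order_tendstoD(2)[where y = "K * 0"]) auto
  then show ?thesis by eventually_elim (simp add: mult.commute)
qed

section \<open>Choice of the constants, existence of fixed points, and instability\<close>

theorem theorem3p1:
  fixes w :: "'n::finite \<Rightarrow> real ^ 'd::finite"
    and J :: "'n set"
    and P B :: "(real ^ 'd) set"
  assumes distinct: "inj w"
    and unit: "\<And>j. norm (w j) = 1"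
    and J_nonempty: "J \<noteq> {}"
    and P: "P = convex hull (w ` J)"
    and B: "orthonormal_basis_of B (affine_orthogonal P)"
    and CIPS_J: "CIPS w J"
    and CIPS_facets: "\<And>F. F facet_of P \<Longrightarrow> CIPS w (vertex_indices w J F)"
  shows "\<exists>\<eta> \<epsilon>0 (\<beta> :: real \<Rightarrow> real).
           0 < \<eta> \<and> \<eta> < 1 \<and> 0 < \<epsilon>0 \<and>
           (\<forall>\<epsilon>\<in>{0<..<\<epsilon>0}. \<beta> \<epsilon> > 0) \<and>
           filterlim \<beta> at_top (at_right 0) \<and>
           (\<forall>\<epsilon>\<in>{0<..<\<epsilon>0}.
              thickened_polytope P B \<eta> \<epsilon> \<inter> Fix (hopfield (pattern_matrix w) (\<beta> \<epsilon>)) \<noteq> {}) \<and>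
           (card J > 1 \<longrightarrow>
              (\<exists>\<beta>0 > 0. \<forall>\<epsilon>\<in>{0<..<\<epsilon>0}. \<beta> \<epsilon> > \<beta>0 \<longrightarrow>
                 (\<forall>x \<in> thickened_polytope P B \<eta> \<epsilon> \<inter> Fix (hopfield (pattern_matrix w) (\<beta> \<epsilon>)).
                    unstable_fixed_point (hopfield (pattern_matrix w) (\<beta> \<epsilon>)) x)))"
proof -
  let ?f = "\<lambda>\<beta>. hopfield (pattern_matrix w) \<beta>"
  have wJ: "finite (w ` J)" "w ` J \<noteq> {}" using J_nonempty by auto
  have compP: "compact P" unfolding P by (intro compact_convex_hull finite_imp_compact) auto
  have convP: "convex P" unfolding P by simp
  have polyP: "polytope P" unfolding P by (simp add: polytope_convex_hull)
  have wP: "w j \<in> P" if "j \<in> J" for j unfolding P using that by (auto intro: hull_inc)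
  have affP: "x \<in> affine hull P" if "x \<in> P" for x using that by (rule hull_inc)
  have norm_P: "norm x \<le> 1" if "x \<in> P" for x
  proof -
    have "P \<subseteq> cball 0 1" unfolding P by (rule hull_minimal) (use unit in auto)
    then show ?thesis using that by auto
  qed
  define b where "b = vertex_mean P"
  have bP: "b \<in> P" unfolding b_def P by (rule vertex_mean_convex_hull[OF wJ])
  have b_aff: "b \<in> affine hull P" by (rule affP[OF bP])

  obtain H :: "(real ^ 'd) set set" and a c where H: "finite H" "P = affine hull P \<inter> {x. \<forall>h\<in>H. a h \<bullet> x \<le> c h}"
      and facet: "\<And>h. h \<in> H \<Longrightarrow> P \<inter> {x. a h \<bullet> x = c h} facet_of P"
      and parallel: "\<And>h x. h \<in> H \<Longrightarrow> x \<in> affine hull P \<Longrightarrow> x + a h \<in> affine hull P"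
    using that by (rule polytope_facet_representation[OF polyP])
  have leP: "a h \<bullet> x \<le> c h" if "h \<in> H" "x \<in> P" for h x
    using H(2) that by blast
  \<comment> \<open>Facet normals are orthogonal to \<open>B\<close>, so removing normal parts never
    affects a facet inequality.\<close>
  have aB: "a h \<bullet> v = 0" if "h \<in> H" "v \<in> B" for h v
    using orthonormal_basis_of_inner_eq[OF B that(2) parallel[OF that(1) b_aff] b_aff]
    by (simp add: inner_add_right inner_commute)

  have "\<exists>g d. g > 0 \<and> d > 0 \<and> (\<forall>x p. p \<in> P \<longrightarrow> a h \<bullet> p \<ge> c h - d \<longrightarrow> dist x p \<le> g \<longrightarrow>
       (\<exists>j. a h \<bullet> w j = c h \<and> (\<forall>i. a h \<bullet> w i \<noteq> c h \<longrightarrow> w i \<bullet> x + g \<le> w j \<bullet> x)))" if "h \<in> H" for h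
    by (rule facet_gap[of w J "a h" "c h", folded P, OF leP[OF that] facet[OF that]
          CIPS_facets[OF facet[OF that]]]) blast+
  then obtain g d where gd: "\<And>h. h \<in> H \<Longrightarrow> g h > 0" "\<And>h. h \<in> H \<Longrightarrow> d h > 0"
      and gap: "\<And>h x p. h \<in> H \<Longrightarrow> p \<in> P \<Longrightarrow> a h \<bullet> p \<ge> c h - d h \<Longrightarrow> dist x p \<le> g h \<Longrightarrow>
       \<exists>j. a h \<bullet> w j = c h \<and> (\<forall>i. a h \<bullet> w i \<noteq> c h \<longrightarrow> w i \<bullet> x + g h \<le> w j \<bullet> x)"
    by metis
  obtain gJ where gJ: "gJ > 0" and gapJ: "\<And>u v. v \<in> P \<Longrightarrow> dist u v \<le> gJ
           \<Longrightarrow> \<exists>j\<in>J. \<forall>i. i \<notin> J \<longrightarrow> w i \<bullet> u + gJ \<le> w j \<bullet> u"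
    using that by (rule CIPS_uniform_gap[OF CIPS_J, folded P])

  \<comment> \<open>\<open>m h\<close> is the slack of the vertex mean; with
    \<open>\<eta> = 1 - s\<close> the facet inequality of the scaled polytope is tightened by
    \<open>s * m h\<close>.\<close>
  define m where "m h = c h - a h \<bullet> b" for h
  have m: "m h > 0" if "h \<in> H" for h
  proof -
    have "P \<inter> {x. a h \<bullet> x = c h} \<noteq> P"
      using facet[OF that] facet_of_irrefl by metis
    then obtain y where "y \<in> P" "a h \<bullet> y \<noteq> c h" by blast
    then show ?thesis
      using inner_vertex_mean_less[OF wJ, of "a h" "c h" y] leP[OF that]
      by (simp add: m_def b_def P)
  qed

  \<comment> \<open>The bound by \<open>d h\<close> puts each facet of the scaled polytope inside
    the layer where the facet gap is available.\<close>
  obtain s where s: "0 < s" "s < 1" "\<And>h. h \<in> H \<Longrightarrow> s * m h < d h"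
    by (rule finite_uniform_scale[OF H(1), of d m]) (use gd(2) that in blast)+
  define \<eta> where "\<eta> = 1 - s"
  have \<eta>: "0 < \<eta>" "\<eta> < 1" using s by (auto simp: \<eta>_def)
  \<comment> \<open>Points outside that layer have slack above \<open>d h - s * m h\<close> in the
    scaled inequality, and a reversed displacement changes \<open>a h\<close> by at most
    \<open>t * (2 * norm (a h))\<close>.\<close>
  obtain t where t: "0 < t" "t < 1" "\<And>h. h \<in> H \<Longrightarrow> t * (2 * norm (a h)) < d h - s * m h"
  proof (rule finite_uniform_scale[OF H(1), of "\<lambda>h. d h - s * m h" "\<lambda>h. 2 * norm (a h)"])
    show "d h - s * m h > 0" if "h \<in> H" for h using s(3)[OF that] by simp
  qed blast
  have scaled_sub: "scaled_polytope P \<eta> \<subseteq> P"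
    using scaled_polytope_subset[of P \<eta>] convP bP \<eta> by (simp add: b_def)
  then have scaled_aff: "scaled_polytope P \<eta> \<subseteq> affine hull P" using affP by blast
  have b_scaled: "b \<in> scaled_polytope P \<eta>"
    using bP unfolding scaled_polytope_def b_def by (intro image_eqI[of _ _ "vertex_mean P"]) auto
  have scaled_iff: "y \<in> scaled_polytope P \<eta> \<longleftrightarrow>
      y \<in> affine hull P \<and> (\<forall>h\<in>H. a h \<bullet> y \<le> c h - s * m h)" for y
    using scaled_polytope_iff[OF H(2), of \<eta> y] b_aff \<eta>(1) by (simp add: b_def \<eta>_def m_def)

  \<comment> \<open>\<open>\<beta> \<epsilon>\<close> is chosen so that the normal part of \<open>f x - b\<close> is at most \<open>\<epsilon>\<close>.\<close>
  define M where "M = 2 * real CARD('n) * real (card B) + 1"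
  have "M > 0" by (simp add: M_def add_nonneg_pos)
  define \<beta> where "\<beta> \<epsilon> = ln (M * inverse \<epsilon>) / gJ" for \<epsilon>
  have \<beta>_lim: "filterlim \<beta> at_top (at_right 0)"
  proof -
    have "filterlim (\<lambda>\<epsilon>. M * inverse \<epsilon>) at_top (at_right 0)"
      by (rule filterlim_tendsto_pos_mult_at_top[OF tendsto_const \<open>M > 0\<close> filterlim_inverse_at_top_right])
    then have "filterlim (\<lambda>\<epsilon>. ln (M * inverse \<epsilon>)) at_top (at_right 0)"
      by (rule filterlim_compose[OF ln_at_top])
    then have "filterlim (\<lambda>\<epsilon>. (1 / gJ) * ln (M * inverse \<epsilon>)) at_top (at_right 0)"
      using gJ by (intro filterlim_tendsto_pos_mult_at_top[OF tendsto_const]) auto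
    then show ?thesis by (simp add: \<beta>_def[abs_def])
  qed
  have exp_\<beta>: "exp (- \<beta> \<epsilon> * gJ) = \<epsilon> / M" if "\<epsilon> > 0" for \<epsilon>
    using that gJ \<open>M > 0\<close> by (simp add: \<beta>_def exp_minus field_simps)

  \<comment> \<open>\<open>r\<close> bounds the norm on the scaled polytope. Thickening by less than
    \<open>(1 - r) / 2\<close> then keeps norms below \<open>(1 + r) / 2\<close>; for a single
    pattern \<rho> takes the default value 1.\<close>
  define r where "r = \<eta> + (1 - \<eta>) * norm b"
  define \<rho> where "\<rho> = (if card J > 1 then (1 - r) / 2 else 1)"
  have r: "r < 1" if "card J > 1"
  proof -
    have "card (w ` J) = card J"
      using distinct by (intro card_image) (auto intro: inj_on_subset)
    then have "norm b < 1"
      unfolding b_def P using that unit by (intro norm_vertex_mean_less) auto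
    then have "(1 - \<eta>) * norm b < (1 - \<eta>) * 1" using \<eta> by (intro mult_strict_left_mono) auto
    then show ?thesis by (simp add: r_def)
  qed
  then have \<rho>: "\<rho> > 0" by (simp add: \<rho>_def)

  define K where "K h = real CARD('n) * (norm (a h) + \<bar>c h\<bar>)" for h
  \<comment> \<open>The bounds by \<open>gJ\<close> and \<open>g h\<close> keep thickened points
    within reach of the gaps. The last condition holds for small \<epsilon> although
    \<open>\<beta>\<close> is tuned to \<open>gJ\<close> alone, because \<open>s * m h\<close> does
    not shrink with \<epsilon>.\<close>
  have "eventually (\<lambda>\<epsilon>. \<epsilon> < gJ \<and> \<epsilon> < \<rho> \<and> \<beta> \<epsilon> > 0 \<and>
      (\<forall>h\<in>H. \<epsilon> < g h \<and> K h * exp (- \<beta> \<epsilon> * g h) \<le> s * m h)) (at_right 0)"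
  proof (intro eventually_conj eventually_ball_finite[OF H(1)] ballI)
    have lt: "eventually (\<lambda>\<epsilon>. \<epsilon> < k) (at_right 0)" if "k > 0" for k :: real
      using eventually_at_right_real[OF that] by eventually_elim simp
    show "eventually (\<lambda>\<epsilon>. \<epsilon> < gJ) (at_right 0)" "eventually (\<lambda>\<epsilon>. \<epsilon> < \<rho>) (at_right 0)"
      by (rule lt, fact)+
    show "eventually (\<lambda>\<epsilon>. \<epsilon> < g h) (at_right 0)" if "h \<in> H" for h
      by (rule lt[OF gd(1)[OF that]])
    show "eventually (\<lambda>\<epsilon>. \<beta> \<epsilon> > 0) (at_right 0)"
      using \<beta>_lim by (simp add: filterlim_at_top_dense)
    show "eventually (\<lambda>\<epsilon>. K h * exp (- \<beta> \<epsilon> * g h) \<le> s * m h) (at_right 0)" if "h \<in> H" for h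
      using eventually_compose_filterlim[OF eventually_scaled_exp_le \<beta>_lim] gd(1)[OF that] m[OF that] s(1)
      by auto
  qed
  then obtain \<epsilon>0 where "\<epsilon>0 > 0" and small: "\<And>\<epsilon>. 0 < \<epsilon> \<Longrightarrow> \<epsilon> < \<epsilon>0 \<Longrightarrow>
      \<epsilon> < gJ \<and> \<epsilon> < \<rho> \<and> \<beta> \<epsilon> > 0 \<and> (\<forall>h\<in>H. \<epsilon> < g h \<and> K h * exp (- \<beta> \<epsilon> * g h) \<le> s * m h)"
    unfolding eventually_at_right[OF zero_less_one] by blast

  have proj_small: "x - basis_proj B (x - b) \<in> scaled_polytope P \<eta> \<and> dist x (x - basis_proj B (x - b)) \<le> \<epsilon>"
    if "x \<in> thickened_polytope P B \<eta> \<epsilon>" "\<epsilon> > 0" for x \<epsilon>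
  proof -
    have "norm (basis_proj B (x - b)) \<le> (\<Sum>v\<in>B. \<bar>v \<bullet> (x - b)\<bar>)"
      by (rule norm_basis_proj_le) (use B in \<open>simp add: orthonormal_basis_of_def\<close>)
    then show ?thesis
      using that thickened_polytope_iff[OF B b_aff scaled_aff] by (fastforce simp: dist_norm)
  qed

  have "thickened_polytope P B \<eta> \<epsilon> \<inter> Fix (?f (\<beta> \<epsilon>)) \<noteq> {}" if "\<epsilon> \<in> {0<..<\<epsilon>0}" for \<epsilon>
  proof -
    have \<epsilon>: "\<epsilon> > 0" "\<epsilon> < gJ" "\<beta> \<epsilon> > 0" using that small[of \<epsilon>] by auto
    have \<epsilon>h: "\<epsilon> < g h" "K h * exp (- \<beta> \<epsilon> * g h) \<le> s * m h" if "h \<in> H" for h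
      using that \<open>\<epsilon> \<in> {0<..<\<epsilon>0}\<close> small[of \<epsilon>] by auto
    obtain x where "x \<in> thickened_polytope P B \<eta> \<epsilon>" "?f (\<beta> \<epsilon>) x = x"
    proof (rule fixed_point_thickened_polytope[OF B b_aff scaled_aff \<epsilon>(1) compP convP b_scaled
          continuous_on_hopfield t(1)])
      fix x assume x: "x \<in> thickened_polytope P B \<eta> \<epsilon>"
      let ?y = "?f (\<beta> \<epsilon>) x"
      define p where "p = x - basis_proj B (x - b)"
      have p: "p \<in> scaled_polytope P \<eta>" "p \<in> P" "dist x p \<le> \<epsilon>"
        using proj_small[OF x \<epsilon>(1)] scaled_sub by (auto simp: p_def)

      obtain j where j: "j \<in> J" "\<And>i. i \<notin> J \<Longrightarrow> w i \<bullet> x + gJ \<le> w j \<bullet> x"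
        using gapJ[OF p(2), of x] p(3) \<epsilon>(2) by fastforce
      have "\<bar>v \<bullet> (?y - b)\<bar> \<le> real CARD('n) * 2 * (\<epsilon> / M)" if "v \<in> B" for v
      proof -
        have "norm v = 1" using B that by (simp add: orthonormal_basis_of_def)
        have "\<bar>v \<bullet> w i - v \<bullet> b\<bar> \<le> 2" for i
        proof -
          have "\<bar>v \<bullet> (w i - b)\<bar> \<le> norm v * norm (w i - b)" by (rule Cauchy_Schwarz_ineq2)
          also have "\<dots> \<le> norm (w i) + norm b"
            unfolding \<open>norm v = 1\<close> mult_1 by (rule norm_triangle_ineq4)
          also have "\<dots> \<le> 2" using unit[of i] norm_P[OF bP] by simp
          finally show ?thesis by (simp add: inner_diff_right)
        qed
        moreover have "v \<bullet> w i = v \<bullet> b" if "i \<in> J" for i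
          by (rule orthonormal_basis_of_inner_eq[OF B \<open>v \<in> B\<close> affP[OF wP[OF that]] b_aff])
        ultimately have "\<bar>v \<bullet> ?y - v \<bullet> b\<bar> \<le> real CARD('n) * 2 * exp (- \<beta> \<epsilon> * gJ)"
          using inner_hopfield_close[of "\<beta> \<epsilon>" j J w x gJ v "v \<bullet> b" 2] \<epsilon>(3) j by simp
        then show ?thesis unfolding exp_\<beta>[OF \<epsilon>(1)] by (simp add: inner_diff_right)
      qed
      then have "(\<Sum>v\<in>B. \<bar>v \<bullet> (?y - b)\<bar>) \<le> real (card B) * (real CARD('n) * 2 * (\<epsilon> / M))"
        by (rule sum_bounded_above)
      \<comment> \<open>\<open>M\<close> exceeds the constant of the estimate by 1, which keeps it
        positive even when \<open>B\<close> is empty.\<close>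
      also have "\<dots> = \<epsilon> * ((M - 1) / M)" by (simp add: M_def)
      also have "\<dots> \<le> \<epsilon>" using \<epsilon>(1) \<open>M > 0\<close> by (intro mult_left_le) auto
      finally show "(\<Sum>v\<in>B. \<bar>v \<bullet> (?y - b)\<bar>) \<le> \<epsilon>" .

      define q where "q = ?y - basis_proj B (?y - b)"
      have "p + t *\<^sub>R (p - q) \<in> scaled_polytope P \<eta>"
        unfolding scaled_iff
      proof (intro conjI ballI)
        have "p \<in> affine hull P" "q \<in> affine hull P"
          unfolding p_def q_def by (rule minus_basis_proj_in_affine_hull[OF B b_aff])+
        then show "p + t *\<^sub>R (p - q) \<in> affine hull P"
          by (intro mem_affine_3_minus affine_affine_hull)
      next
        fix h assume h: "h \<in> H"
        have aq: "a h \<bullet> q = a h \<bullet> ?y"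
          by (simp add: q_def basis_proj_def inner_diff_right inner_sum_right aB[OF h])
        have ap: "a h \<bullet> p \<le> c h - s * m h" using p(1) h by (simp add: scaled_iff)
        show "a h \<bullet> (p + t *\<^sub>R (p - q)) \<le> c h - s * m h"
        \<comment> \<open>Near the facet, \<open>q\<close> lies on or beyond the scaled facet, so
          the reversed displacement does not increase \<open>a h\<close>. Away from it, the
          smallness of \<open>t\<close> suffices.\<close>
        proof (cases "a h \<bullet> p \<ge> c h - d h")
          case True
          obtain k where k: "a h \<bullet> w k = c h"
              "\<And>i. a h \<bullet> w i \<noteq> c h \<Longrightarrow> w i \<bullet> x + g h \<le> w k \<bullet> x"
            using gap[OF h p(2) True, of x] p(3) \<epsilon>h(1)[OF h] by fastforce
          have "\<bar>a h \<bullet> w i - c h\<bar> \<le> norm (a h) + \<bar>c h\<bar>" for i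
            using Cauchy_Schwarz_ineq2[of "a h" "w i"] unit[of i] by simp
          then have "\<bar>a h \<bullet> ?y - c h\<bar> \<le> K h * exp (- \<beta> \<epsilon> * g h)"
            unfolding K_def using \<epsilon>(3) k
            by (intro inner_hopfield_close[where j = k and I = "{i. a h \<bullet> w i = c h}"]) auto
          then have "a h \<bullet> q \<ge> c h - s * m h" using \<epsilon>h(2)[OF h] aq by linarith
          then have "t * (a h \<bullet> p - a h \<bullet> q) \<le> 0"
            using ap t(1) by (intro mult_nonneg_nonpos) auto
          then show ?thesis using ap by (simp add: inner_add_right inner_diff_right)
        next
          case False
          have "\<bar>a h \<bullet> z\<bar> \<le> norm (a h)" if "norm z \<le> 1" for z
            using Cauchy_Schwarz_ineq2[of "a h" z] mult_left_le[OF that norm_ge_zero[of "a h"]]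
            by linarith
          from this[OF norm_P[OF p(2)]] this[of ?y]
          have "\<bar>a h \<bullet> p\<bar> \<le> norm (a h)" "\<bar>a h \<bullet> ?y\<bar> \<le> norm (a h)"
            using norm_hopfield_le[of w 1 "\<beta> \<epsilon>" x] unit by auto
          then have "t * (a h \<bullet> p - a h \<bullet> q) \<le> t * (2 * norm (a h))"
            using t(1) aq by (intro mult_left_mono) auto
          then show ?thesis
            using t(3)[OF h] False by (simp add: inner_add_right inner_diff_right)
        qed
      qed
      then show "x - basis_proj B (x - b) + t *\<^sub>R (x - basis_proj B (x - b) - (?y - basis_proj B (?y - b)))
          \<in> scaled_polytope P \<eta>"
        by (simp only: p_def q_def)
    qed blast
    then show ?thesis by (auto simp: Fix_def)
  qed
  moreover have "\<exists>\<beta>0 > 0. \<forall>\<epsilon>\<in>{0<..<\<epsilon>0}. \<beta> \<epsilon> > \<beta>0 \<longrightarrow>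
      (\<forall>x \<in> thickened_polytope P B \<eta> \<epsilon> \<inter> Fix (?f (\<beta> \<epsilon>)). unstable_fixed_point (?f (\<beta> \<epsilon>)) x)"
    if "card J > 1"
  proof -
    define R where "R = (1 + r) / 2"
    have "0 \<le> r" using \<eta> by (simp add: r_def)
    then have R: "0 \<le> R" "R < 1" using r[OF that] by (auto simp: R_def)
    then have R2: "1 - R\<^sup>2 > 0" by (simp add: power_less_one_iff abs_square_less_1)
    show ?thesis
    \<comment> \<open>Every point of the thickening has norm at most \<open>R < 1\<close>, so this
      threshold makes the trace exceed the dimension.\<close>
    proof (intro exI[of _ "real CARD('d) / (1 - R\<^sup>2)"] conjI ballI impI)
      show "real CARD('d) / (1 - R\<^sup>2) > 0" using R2 by simp
      fix \<epsilon> x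
      assume \<epsilon>: "\<epsilon> \<in> {0<..<\<epsilon>0}" "\<beta> \<epsilon> > real CARD('d) / (1 - R\<^sup>2)"
        and x: "x \<in> thickened_polytope P B \<eta> \<epsilon> \<inter> Fix (?f (\<beta> \<epsilon>))"
      define p where "p = x - basis_proj B (x - b)"
      have p: "p \<in> scaled_polytope P \<eta>" "dist x p \<le> \<epsilon>"
        using proj_small[of x \<epsilon>] x \<epsilon>(1) by (auto simp: p_def)
      obtain z where z: "z \<in> P" "p = (1 - \<eta>) *\<^sub>R b + \<eta> *\<^sub>R z"
        using p(1) by (auto simp: scaled_polytope_affinity b_def)
      have "norm p \<le> norm ((1 - \<eta>) *\<^sub>R b) + norm (\<eta> *\<^sub>R z)"
        unfolding z(2) by (rule norm_triangle_ineq)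
      also have "\<dots> \<le> r"
        using \<eta> norm_P[OF z(1)] by (simp add: r_def mult_left_le)
      finally have "norm x \<le> r + \<epsilon>"
        using p(2) norm_triangle_ineq[of "x - p" p] by (simp add: dist_norm)
      also have "\<dots> \<le> R" using small[of \<epsilon>] \<epsilon>(1) that by (simp add: \<rho>_def R_def field_simps)
      finally have "(norm x)\<^sup>2 \<le> R\<^sup>2" by (simp add: power_mono)
      moreover have "\<beta> \<epsilon> > 0" using small[of \<epsilon>] \<epsilon>(1) by simp
      ultimately have "\<beta> \<epsilon> * (1 - R\<^sup>2) \<le> \<beta> \<epsilon> * (1 - (norm x)\<^sup>2)" by simp
      moreover have "real CARD('d) < \<beta> \<epsilon> * (1 - R\<^sup>2)"
        using \<epsilon>(2) R2 by (simp add: pos_divide_less_eq)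
      ultimately show "unstable_fixed_point (?f (\<beta> \<epsilon>)) x"
        using x unit by (intro unstable_fixed_point_hopfield) auto
    qed
  qed
  moreover have "\<forall>\<epsilon>\<in>{0<..<\<epsilon>0}. \<beta> \<epsilon> > 0" using small by auto
  ultimately show ?thesis
    using \<eta> \<open>\<epsilon>0 > 0\<close> \<beta>_lim by blast
qed

end
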